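(* Assume the joint regression model (M), the regularity conditions (A-1), (A-2), (A-3), and that the following moments are finite: $\mathbb{E}[\|X\|^2]$, $\mathbb{E}[\sup_{\theta\in\Theta}|G_1(X'\theta^q)|]$, $\mathbb{E}[|G_1(Y)|]$, $\mathbb{E}[|a(Y)|]$, $\mathbb{E}[\|X\|\sup_{\theta\in\Theta}|G_2(X'\theta^e)|]$, $\mathbb{E}[\sup_{\theta\in\Theta}|G_2(X'\theta^e)|\,\mathbb{E}[|Y|\mid X]]$, $\mathbb{E}[\sup_{\theta\in\Theta}|\mathcal G_2(X'\theta^e)|]$. Then for every sequence $\hat\theta_{\rho,n}\in\Theta$ such that $\frac1n\sum_{i=1}^n\rho(Y_i,X_i,\hat\theta_{\rho,n})\le\frac1n\sum_{i=1}^n\rho(Y_i,X_i,\theta_0)+o_P(1)$, it holds that $\hat\theta_{\rho,n}\to\theta_0$ in probability.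
   Context: Fix $\alpha\in(0,1)$ and $k\in\mathbb{N}$. Let $(\Omega,\mathcal F,P)$ be a complete probability space and $Y:\Omega\to\mathbb{R}$, $X:\Omega\to\mathbb{R}^k$ random variables. For a real random variable $Z$ with distribution function $F$, $Q_\alpha(Z)=\inf\{z\in\mathbb{R}:F(z)\ge\alpha\}$ and $\mathrm{ES}_\alpha(Z)=\frac1\alpha\int_0^\alpha Q_u(Z)\,\mathrm{d}u$; $Q_\alpha(\cdot\mid X)$ and $\mathrm{ES}_\alpha(\cdot\mid X)$ denote these functionals of the conditional distribution given $X$. $F_{Y|X}$ and $f_{Y|X}$ denote the conditional distribution function and density of $Y$ given $X$. Vectors $\theta\in\mathbb{R}^{2k}$ are written $\theta=(\theta^{q\prime},\theta^{e\prime})'$ with $\theta^q,\theta^e\in\mathbb{R}^k$. $\|\cdot\|$ is the maximum norm on vectors. $G^{(j)}$ denotes the $j$-th derivative of a real function $G$. Model (M): $Y=X'\theta^q_0+u^q$ and $Y=X'\theta^e_0+u^e$ where $Q_\alpha(u^q\mid X)=0$ and $\mathrm{ES}_\alpha(u^e\mid X)=0$; $\theta_0=(\theta_0^{q\prime},\theta_0^{e\prime})'\in\Theta$, where $\Theta\subset\mathbb{R}^{2k}$ is compact with nonempty interior. (A-1): $(Y_i,X_i)$, $i=1,\dots,n$, are iid with the distribution of $(Y,X)$; the conditional distribution $F_{Y|X}$ has finite second moments and is absolutely continuous with density $f_{Y|X}$ that is strictly positive, continuous and bounded in a neighbourhood of $X'\theta^q_0$. (A-2): $\mathbb{E}[XX']$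 is positive definite. (A-3): $G_1$ is twice continuously differentiable, increasing and integrable; $\mathcal G_2$ is three times continuously differentiable with $\mathcal G_2^{(1)}=G_2$, and $G_2$ and $G_2^{(1)}$ are strictly positive; $a$ is integrable. The loss is $\rho(Y,X,\theta)=(\mathbf 1_{\{Y\le X'\theta^q\}}-\alpha)G_1(X'\theta^q)-\mathbf 1_{\{Y\le X'\theta^q\}}G_1(Y)+G_2(X'\theta^e)\big(X'\theta^e-X'\theta^q+\frac{(X'\theta^q-Y)\mathbf 1_{\{Y\le X'\theta^q\}}}{\alpha}\big)-\mathcal G_2(X'\theta^e)+a(Y)$. *)

theory Defs
  imports "HOL-Probability.Probability"
begin

definition maxnorm :: "real ^ 'k \<Rightarrow> real" where
  "maxnorm x = Max (range (\<lambda>i. \<bar>x $ i\<bar>))"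

definition quantile :: "(real \<Rightarrow> real) \<Rightarrow> real \<Rightarrow> real" where
  "quantile F \<alpha> = Inf {z. \<alpha> \<le> F z}"

definition expected_shortfall :: "(real \<Rightarrow> real) \<Rightarrow> real \<Rightarrow> real" where
  "expected_shortfall F \<alpha> = (1 / \<alpha>) * (LBINT u=0..\<alpha>. quantile F u)"

definition cond_cdf :: "('x \<Rightarrow> real \<Rightarrow> real) \<Rightarrow> 'x \<Rightarrow> real \<Rightarrow> real" where
  "cond_cdf f x y = (LINT t|lborel. indicator {..y} t * f x t)"

definition Ck_real :: "nat \<Rightarrow> (real \<Rightarrow> real) \<Rightarrow> bool" where
  "Ck_real k g \<longleftrightarrow> (\<forall>j<k. \<forall>x. ((deriv ^^ j) g) differentiable (at x))
                    \<and> continuous_on UNIV ((deriv ^^ k) g)"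

definition pos_def_mat :: "real ^ 'k ^ 'k \<Rightarrow> bool" where
  "pos_def_mat A \<longleftrightarrow> transpose A = A \<and> (\<forall>v. v \<noteq> 0 \<longrightarrow> v \<bullet> (A *v v) > 0)"

definition rho_loss ::
  "real \<Rightarrow> (real \<Rightarrow> real) \<Rightarrow> (real \<Rightarrow> real) \<Rightarrow> (real \<Rightarrow> real) \<Rightarrow> (real \<Rightarrow> real)
   \<Rightarrow> real \<Rightarrow> (real ^ 'k) \<Rightarrow> ((real ^ 'k) \<times> (real ^ 'k)) \<Rightarrow> real" where
  "rho_loss \<alpha> G1 G2 \<G>2 a y x \<theta> =
     (let q = x \<bullet> fst \<theta>; e = x \<bullet> snd \<theta>; I = (if y \<le> q then 1 else 0 :: real)
      in (I - \<alpha>) * G1 q - I * G1 y + G2 e * (e - q + (q - y) * I / \<alpha>) - \<G>2 e + a y)"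

definition conv_in_prob :: "'a measure \<Rightarrow> (nat \<Rightarrow> 'a \<Rightarrow> 'b::metric_space) \<Rightarrow> 'b \<Rightarrow> bool" where
  "conv_in_prob M Z c \<longleftrightarrow>
     (\<forall>\<epsilon>>0. (\<lambda>n. measure M {\<omega> \<in> space M. dist (Z n \<omega>) c > \<epsilon>}) \<longlonglongrightarrow> 0)"

end

theory Submission
  imports Defs
begin

text \<open>
  Identification. Let \<open>q\<close>, \<open>e\<close> be the linear predictors at \<open>\<theta>\<close> and \<open>q0\<close>, \<open>e0\<close> those at the true
  parameter, and condition on \<open>X\<close>. Since \<open>P(Y \<le> q0) = \<alpha>\<close> and \<open>E[Y 1{Y \<le> q0}] = \<alpha> e0\<close>, the conditional mean
  of the loss at \<open>\<theta>\<close> exceeds that at the true parameter by at least the Bregman distance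
  \<open>G2 e (e - e0) - \<G>2 e + \<G>2 e0\<close> plus \<open>G2 e / \<alpha>\<close> times the mean of
  \<open>(q - Y) (1{Y \<le> q} - 1{Y \<le> q0})\<close>. The first term vanishes only for \<open>e = e0\<close> because \<open>G2\<close> is strictly
  increasing, the second only for \<open>q = q0\<close> because the conditional density is positive near \<open>q0\<close>; positive
  definiteness of \<open>E[XX']\<close> turns this into \<open>\<theta> = \<theta>0\<close>.

  Consistency is then Wald's argument, as the loss is continuous in \<open>\<theta>\<close> and has an integrable envelope:
  around each wrong parameter the local infimum of the loss still has a mean exceeding the minimal risk, finitely
  many such neighbourhoods cover the complement of a ball around \<open>\<theta>0\<close>, and the weak law of large
  numbers applies to each of these infima.
\<close>

section \<open>Weak law of large numbers\<close>

text \<open>Only a first moment is available, so the variables are truncated at a level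
  \<open>K\<close>: the bounded parts concentrate by Hoeffding's inequality, and the average of the
  discarded parts is controlled by Markov's inequality.\<close>

lemma (in prob_space) weak_law_of_large_numbers:
  fixes Z :: "nat \<Rightarrow> 'a \<Rightarrow> real"
  assumes indep: "indep_vars (\<lambda>_. borel) Z UNIV"
    and distr: "\<And>i. distr M borel (Z i) = distr M borel W"
    and W: "integrable M W"
  shows "conv_in_prob M (\<lambda>n \<omega>. 1 / real n * (\<Sum>i<n. Z i \<omega>)) (expectation W)"
  unfolding conv_in_prob_def
proof (intro allI impI tendstoI)
  fix \<epsilon> \<eta> :: real
  assume \<epsilon>: "0 < \<epsilon>" and \<eta>: "0 < \<eta>"
  have W_meas [measurable]: "W \<in> borel_measurable M"
    using W by simp
  have Z_meas [measurable]: "Z i \<in> borel_measurable M" for i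
    using indep by (auto simp: indep_vars_def)
  have transfer: "integrable M (\<lambda>\<omega>. h (Z i \<omega>)) \<longleftrightarrow> integrable M (\<lambda>\<omega>. h (W \<omega>))"
      "expectation (\<lambda>\<omega>. h (Z i \<omega>)) = expectation (\<lambda>\<omega>. h (W \<omega>))"
    if [measurable]: "h \<in> borel_measurable borel" for h :: "real \<Rightarrow> real" and i
  proof -
    have "integrable (distr M borel (Z i)) h \<longleftrightarrow> integrable (distr M borel W) h"
      "integral\<^sup>L (distr M borel (Z i)) h = integral\<^sup>L (distr M borel W) h"
      by (simp_all only: distr)
    thus "integrable M (\<lambda>\<omega>. h (Z i \<omega>)) \<longleftrightarrow> integrable M (\<lambda>\<omega>. h (W \<omega>))"
      "expectation (\<lambda>\<omega>. h (Z i \<omega>)) = expectation (\<lambda>\<omega>. h (W \<omega>))"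
      by (simp_all add: integrable_distr_eq integral_distr)
  qed
  define tail where "tail = (\<lambda>(K::nat) z :: real. if \<bar>z\<bar> \<le> K then 0 else \<bar>z\<bar>)"
  have tail_meas [measurable]: "tail K \<in> borel_measurable borel" for K
    by (simp add: tail_def)
  have tail_nonneg: "0 \<le> tail K z" for K z
    by (simp add: tail_def)
  have "(\<lambda>K. expectation (\<lambda>\<omega>. tail K (W \<omega>))) \<longlonglongrightarrow> expectation (\<lambda>\<omega>. 0)"
  proof (rule integral_dominated_convergence[where w = "\<lambda>\<omega>. \<bar>W \<omega>\<bar>"])
    show "AE \<omega> in M. (\<lambda>K. tail K (W \<omega>)) \<longlonglongrightarrow> 0"
    proof (intro AE_I2 tendsto_eventually)
      fix \<omega>
      show "\<forall>\<^sub>F K in sequentially. tail K (W \<omega>) = 0"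
        using eventually_ge_at_top[of "nat \<lceil>\<bar>W \<omega>\<bar>\<rceil>"]
        by eventually_elim (auto simp: tail_def nat_le_iff ceiling_le_iff)
    qed
  qed (use W in \<open>auto simp: tail_def\<close>)
  hence "(\<lambda>K. expectation (\<lambda>\<omega>. tail K (W \<omega>))) \<longlonglongrightarrow> 0"
    by simp
  \<comment> \<open>The bound \<open>\<epsilon> / 3\<close> limits the shift of the mean caused by
    truncation; the bound \<open>\<epsilon> * \<eta> / 6\<close>, divided by the Markov threshold
    \<open>\<epsilon> / 3\<close>, yields the probability \<open>\<eta> / 2\<close>. Taking
    \<open>1 \<le> K\<close> keeps the Hoeffding interval from degenerating to a point.\<close>
  moreover have "0 < min (\<epsilon> / 3) (\<epsilon> * \<eta> / 6)"
    using \<epsilon> \<eta> by simp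
  ultimately have "\<forall>\<^sub>F K in sequentially. expectation (\<lambda>\<omega>. tail K (W \<omega>)) < min (\<epsilon> / 3) (\<epsilon> * \<eta> / 6) \<and> 1 \<le> K"
    by (intro eventually_conj order_tendstoD(2) eventually_ge_at_top)
  then obtain K where K: "1 \<le> K" and K_tail: "expectation (\<lambda>\<omega>. tail K (W \<omega>)) < min (\<epsilon> / 3) (\<epsilon> * \<eta> / 6)"
    using eventually_happens'[OF sequentially_bot] by blast
  define \<tau> where "\<tau> = expectation (\<lambda>\<omega>. tail K (W \<omega>))"
  have \<tau>: "\<tau> < \<epsilon> / 3" "\<tau> < \<epsilon> * \<eta> / 6"
    using K_tail by (auto simp: \<tau>_def)
  define trunc where "trunc = (\<lambda>z :: real. if \<bar>z\<bar> \<le> K then z else 0)"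
  have trunc_meas [measurable]: "trunc \<in> borel_measurable borel"
    by (simp add: trunc_def)
  have trunc_tail: "\<bar>z - trunc z\<bar> \<le> tail K z" for z
    by (auto simp: trunc_def tail_def)
  have trunc_bound: "trunc z \<in> {- real K..real K}" for z
    by (auto simp: trunc_def)
  have trunc_int: "integrable M (\<lambda>\<omega>. trunc (W \<omega>))"
    using trunc_bound by (intro integrable_const_bound[where B = K]) (auto simp: abs_le_iff minus_le_iff)
  have tail_int: "integrable M (\<lambda>\<omega>. tail K (W \<omega>))"
    by (rule Bochner_Integration.integrable_bound[OF W]) (auto simp: tail_def)
  have mean_diff: "\<bar>expectation W - expectation (\<lambda>\<omega>. trunc (W \<omega>))\<bar> \<le> \<tau>"
  proof -
    have "\<bar>expectation W - expectation (\<lambda>\<omega>. trunc (W \<omega>))\<bar> = \<bar>expectation (\<lambda>\<omega>. W \<omega> - trunc (W \<omega>))\<bar>"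
      using W trunc_int by simp
    also have "\<dots> \<le> expectation (\<lambda>\<omega>. \<bar>W \<omega> - trunc (W \<omega>)\<bar>)"
      by (rule integral_abs_bound)
    also have "\<dots> \<le> \<tau>"
      unfolding \<tau>_def using W trunc_int tail_int trunc_tail by (intro integral_mono) auto
    finally show ?thesis .
  qed
  have trunc_dev: "prob {\<omega> \<in> space M. \<epsilon> / 3 \<le> \<bar>(\<Sum>i<n. trunc (Z i \<omega>)) / n - expectation (\<lambda>\<omega>. trunc (W \<omega>))\<bar>}
      \<le> 2 * exp (- 2 * real n * (\<epsilon> / 3)\<^sup>2 / (2 * K)\<^sup>2)" if n: "0 < n" for n
  proof -
    interpret H: Hoeffding_ineq_iid M "{..<n}" "\<lambda>i \<omega>. trunc (Z i \<omega>)" "\<lambda>\<omega>. trunc (W \<omega>)"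
      "- real K" "real K" "expectation (\<lambda>\<omega>. trunc (W \<omega>))"
    proof (unfold_locales)
      show "indep_vars (\<lambda>_. borel) (\<lambda>i \<omega>. trunc (Z i \<omega>)) {..<n}"
        by (rule indep_vars_compose2[OF indep_vars_subset[OF indep]]) auto
      have "distr M borel (\<lambda>\<omega>. trunc (V \<omega>)) = distr (distr M borel V) borel trunc"
        if "V \<in> borel_measurable M" for V
        using that by (simp add: distr_distr comp_def)
      thus "distr M borel (\<lambda>\<omega>. trunc (Z i \<omega>)) = distr M borel (\<lambda>\<omega>. trunc (W \<omega>))" for i
        by (simp add: distr)
    qed (use trunc_bound in auto)
    show ?thesis
      using H.Hoeffding_ineq_abs_ge'[of "\<epsilon> / 3"] \<epsilon> K n by (simp add: lessThan_empty_iff)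
  qed
  have tail_dev: "prob {\<omega> \<in> space M. \<epsilon> / 3 \<le> (\<Sum>i<n. tail K (Z i \<omega>)) / n} \<le> \<eta> / 2" for n
  proof -
    have int: "integrable M (\<lambda>\<omega>. (\<Sum>i<n. tail K (Z i \<omega>)) / n)"
      using transfer(1)[of "tail K"] tail_int by auto
    have "prob {\<omega> \<in> space M. \<epsilon> / 3 \<le> (\<Sum>i<n. tail K (Z i \<omega>)) / n}
        \<le> expectation (\<lambda>\<omega>. (\<Sum>i<n. tail K (Z i \<omega>)) / n) / (\<epsilon> / 3)"
      using \<epsilon> int tail_nonneg
      by (intro integral_Markov_inequality_measure[where A = "space M"]) (auto intro!: sum_nonneg divide_nonneg_nonneg)
    also have "expectation (\<lambda>\<omega>. (\<Sum>i<n. tail K (Z i \<omega>)) / n) = (\<Sum>i<n. \<tau>) / n"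
      using transfer[of "tail K"] tail_int by (simp add: \<tau>_def)
    \<comment> \<open>For \<open>n = 0\<close> the quotient is 0, so only an inequality holds for
      every \<open>n\<close>.\<close>
    also have "\<dots> \<le> \<tau>"
      using tail_nonneg by (auto simp: \<tau>_def intro: integral_nonneg)
    also have "\<tau> / (\<epsilon> / 3) \<le> \<eta> / 2"
      using \<tau>(2) \<epsilon> by (simp add: field_simps)
    finally show ?thesis
      using \<epsilon> by (simp add: divide_right_mono)
  qed
  have split: "prob {\<omega> \<in> space M. dist (1 / real n * (\<Sum>i<n. Z i \<omega>)) (expectation W) > \<epsilon>}
      \<le> 2 * exp (- 2 * real n * (\<epsilon> / 3)\<^sup>2 / (2 * K)\<^sup>2) + \<eta> / 2" if n: "0 < n" for n
  proof -
    let ?A = "{\<omega> \<in> space M. \<epsilon> / 3 \<le> \<bar>(\<Sum>i<n. trunc (Z i \<omega>)) / n - expectation (\<lambda>\<omega>. trunc (W \<omega>))\<bar>}"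
    let ?B = "{\<omega> \<in> space M. \<epsilon> / 3 \<le> (\<Sum>i<n. tail K (Z i \<omega>)) / n}"
    \<comment> \<open>The deviation is at most the sum of the truncated deviation, the averaged tail
      and the mean shift. The shift stays below \<open>\<epsilon> / 3\<close>, so one of the other
      two reaches \<open>\<epsilon> / 3\<close>.\<close>
    have "{\<omega> \<in> space M. dist (1 / real n * (\<Sum>i<n. Z i \<omega>)) (expectation W) > \<epsilon>} \<subseteq> ?A \<union> ?B"
    proof
      fix \<omega>
      assume "\<omega> \<in> {\<omega> \<in> space M. dist (1 / real n * (\<Sum>i<n. Z i \<omega>)) (expectation W) > \<epsilon>}"
      hence \<omega>: "\<omega> \<in> space M" and dev: "\<epsilon> < \<bar>(\<Sum>i<n. Z i \<omega>) / n - expectation W\<bar>"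
        by (auto simp: dist_real_def)
      have "\<bar>(\<Sum>i<n. Z i \<omega>) - (\<Sum>i<n. trunc (Z i \<omega>))\<bar> \<le> (\<Sum>i<n. tail K (Z i \<omega>))"
        unfolding sum_subtractf[symmetric] by (intro order_trans[OF sum_abs] sum_mono trunc_tail)
      hence "\<bar>(\<Sum>i<n. Z i \<omega>) - (\<Sum>i<n. trunc (Z i \<omega>))\<bar> / n \<le> (\<Sum>i<n. tail K (Z i \<omega>)) / n"
        by (intro divide_right_mono) auto
      moreover have "\<bar>(\<Sum>i<n. Z i \<omega>) - (\<Sum>i<n. trunc (Z i \<omega>))\<bar> / n
          = \<bar>(\<Sum>i<n. Z i \<omega>) / n - (\<Sum>i<n. trunc (Z i \<omega>)) / n\<bar>"
        by (simp add: diff_divide_distrib[symmetric])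
      ultimately show "\<omega> \<in> ?A \<union> ?B"
        using \<omega> dev mean_diff \<tau>(1) by (simp only: Un_iff mem_Collect_eq simp_thms) linarith
    qed
    hence "prob {\<omega> \<in> space M. dist (1 / real n * (\<Sum>i<n. Z i \<omega>)) (expectation W) > \<epsilon>} \<le> prob (?A \<union> ?B)"
      by (rule finite_measure_mono) measurable
    also have "\<dots> \<le> prob ?A + prob ?B"
      by (intro measure_Un_le) measurable
    finally show ?thesis
      using trunc_dev[OF n] tail_dev[of n] by linarith
  qed
  have "(\<lambda>n. 2 * exp (- 2 * real n * (\<epsilon> / 3)\<^sup>2 / (2 * K)\<^sup>2)) \<longlonglongrightarrow> 0"
  proof -
    define c where "c = 2 * (\<epsilon> / 3)\<^sup>2 / (2 * real K)\<^sup>2"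
    have "0 < c"
      using \<epsilon> K by (simp add: c_def)
    hence "(\<lambda>n. 2 * exp (- (c * real n))) \<longlonglongrightarrow> 2 * 0"
      by (intro tendsto_mult tendsto_const filterlim_compose[OF exp_at_bot]
           filterlim_compose[OF filterlim_uminus_at_bot_at_top]
           filterlim_tendsto_pos_mult_at_top[OF tendsto_const] filterlim_real_sequentially)
    thus ?thesis
      by (simp add: c_def mult_ac)
  qed
  hence "\<forall>\<^sub>F n in sequentially. 2 * exp (- 2 * real n * (\<epsilon> / 3)\<^sup>2 / (2 * K)\<^sup>2) < \<eta> / 2"
    by (rule order_tendstoD(2)) (use \<eta> in simp)
  with eventually_gt_at_top[of 0]
  show "\<forall>\<^sub>F n in sequentially.
      dist (prob {\<omega> \<in> space M. dist (1 / real n * (\<Sum>i<n. Z i \<omega>)) (expectation W) > \<epsilon>}) 0 < \<eta>"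
  proof eventually_elim
    case (elim n)
    thus ?case
      using split[of n] by simp
  qed
qed

section \<open>Conditional excess loss\<close>

locale real_density =
  fixes g :: "real \<Rightarrow> real"
  assumes g_meas [measurable]: "g \<in> borel_measurable borel"
    and g_nonneg: "\<And>t. 0 \<le> g t"
    and g_int: "integrable lborel g"
    and g_one: "(LINT t|lborel. g t) = 1"
begin

definition law :: "real measure" where
  "law = density lborel (\<lambda>t. ennreal (g t))"

lemma sets_law [measurable_cong, simp]: "sets law = sets borel"
  by (simp add: law_def)

lemma space_law [simp]: "space law = UNIV"
  by (simp add: law_def)

lemma integral_law:
  fixes h :: "real \<Rightarrow> real"
  assumes [measurable]: "h \<in> borel_measurable borel"
  shows "(LINT t|law. h t) = (LINT t|lborel. h t * g t)"
  using g_nonneg by (simp add: law_def integral_density mult.commute)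

lemma integrable_law:
  fixes h :: "real \<Rightarrow> real"
  assumes [measurable]: "h \<in> borel_measurable borel"
  shows "integrable law h \<longleftrightarrow> integrable lborel (\<lambda>t. h t * g t)"
  using g_nonneg by (simp add: law_def integrable_density mult.commute)

text \<open>\<open>cdf_distribution\<close> brings in the quantile transform \<open>I\<close>: it
  carries the uniform law on the unit interval to \<open>law\<close>, and by
  \<open>pseudoinverse\<close> the conditions \<open>I u \<le> x\<close> and
  \<open>u \<le> cdf law x\<close> are equivalent for \<open>u\<close> strictly between 0 and
  1.\<close>

sublocale cdf_distribution law
proof -
  have "emeasure law (space law) = (\<integral>\<^sup>+t. ennreal (g t) \<partial>lborel)"
    by (simp add: law_def emeasure_density)
  also have "\<dots> = ennreal (LINT t|lborel. g t)"
    using g_int g_nonneg by (intro nn_integral_eq_integral) auto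
  finally have "prob_space law"
    by (intro prob_spaceI) (simp add: g_one)
  thus "cdf_distribution law"
    by (simp add: cdf_distribution_def real_distribution_def real_distribution_axioms_def)
qed

lemma cdf_law: "cdf law y = (LINT t|lborel. indicator {..y} t * g t)"
proof -
  have "cdf law y = (LINT t|law. indicator {..y} t)"
    by (simp add: cdf_def)
  also have "\<dots> = (LINT t|lborel. indicator {..y} t * g t)"
    by (rule integral_law) simp
  finally show ?thesis .
qed

lemma cond_cdf_eq_cdf_law: "f x = g \<Longrightarrow> cond_cdf f x = cdf law"
  by (rule ext) (simp add: cond_cdf_def cdf_law)

text \<open>A density excludes atoms, so the distribution function is continuous; a value above
  \<open>\<alpha>\<close> at \<open>q\<close> would persist slightly to the left of
  \<open>q\<close>, contradicting that \<open>q\<close> is the infimum. The other inequality comes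
  from right continuity, in the form of \<open>pseudoinverse\<close>.\<close>

lemma cdf_quantile:
  assumes \<alpha>: "0 < \<alpha>" "\<alpha> < 1" and q: "quantile (cdf law) \<alpha> = q"
  shows "cdf law q = \<alpha>"
proof (rule antisym)
  show "\<alpha> \<le> cdf law q"
    using pseudoinverse[OF \<alpha>, of q] q by (simp add: quantile_def)
  have "emeasure law {q} = 0"
    unfolding law_def by (subst emeasure_density) (auto intro!: nn_integral_0_iff_AE[THEN iffD2] AE_I[where N = "{q}"] split: split_indicator)
  hence cont: "isCont (cdf law) q"
    by (simp add: isCont_cdf measure_def)
  show "cdf law q \<le> \<alpha>"
  proof (rule ccontr)
    assume "\<not> cdf law q \<le> \<alpha>"
    hence "\<forall>\<^sub>F z in at q. \<alpha> < cdf law z"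
      using cont by (intro order_tendstoD(1)) (auto simp: isCont_def)
    hence "\<forall>\<^sub>F z in at_left q. \<alpha> < cdf law z \<and> z < q"
      by (auto simp: eventually_at_split eventually_at_filter elim: eventually_mono)
    then obtain z where z: "\<alpha> < cdf law z" "z < q"
      using eventually_happens'[OF trivial_limit_at_left_real] by blast
    thus False
      using pseudoinverse[OF \<alpha>, of z] q by (simp add: quantile_def)
  qed
qed

text \<open>Under the quantile transform \<open>t\<close> becomes \<open>I u\<close>, and
  \<open>I u \<le> q\<close> holds exactly when \<open>u \<le> \<alpha>\<close>. The tail mean is
  therefore the integral of the quantile function from 0 to \<open>\<alpha>\<close>.\<close>

lemma expected_shortfall_eq_tail_mean:
  assumes \<alpha>: "0 < \<alpha>" "\<alpha> < 1" and q: "cdf law q = \<alpha>"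
  shows "expected_shortfall (cdf law) \<alpha> = (1 / \<alpha>) * (LINT t|law. t * indicator {..q} t)"
proof -
  have "(LINT t|law. t * indicator {..q} t)
      = (LINT u|restrict_space lborel {0<..<1}. I u * indicator {..q} (I u))"
    by (subst (1) distr_I_eq_M[symmetric]) (rule integral_distr, auto)
  also have "\<dots> = (LINT u|lborel. indicator {0<..<1} u *\<^sub>R (I u * indicator {..q} (I u)))"
    by (rule integral_restrict_space) auto
  also have "\<dots> = (LINT u|lborel. indicator {0<..<\<alpha>} u *\<^sub>R I u)"
  proof (rule integral_cong_AE)
    \<comment> \<open>\<open>I\<close> is known to be measurable only on the open unit interval, so
      it is multiplied by the indicator of that interval to obtain measurability on the whole
      line.\<close>
    have "(\<lambda>u. indicator {0<..<1} u *\<^sub>R I u) \<in> borel_measurable borel"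
      using measurable_CI by (subst (asm) borel_measurable_restrict_space_iff) auto
    hence I_meas: "(\<lambda>u. indicator {0<..<1} u * I u) \<in> borel_measurable lborel"
      by simp
    have "(\<lambda>u. indicator {0<..<1} u *\<^sub>R (I u * indicator {..q} (I u)))
        = (\<lambda>u. indicator {0<..<1} u * I u * indicator {..\<alpha>} u)"
    proof
      show "indicator {0<..<1} u *\<^sub>R (I u * indicator {..q} (I u)) = indicator {0<..<1} u * I u * indicator {..\<alpha>} u" for u
        using pseudoinverse[of u q] q by (cases "u \<in> {0<..<1}") (auto simp: indicator_def)
    qed
    also have "\<dots> \<in> borel_measurable lborel"
      by (intro borel_measurable_times I_meas) simp
    finally show "(\<lambda>u. indicator {0<..<1} u *\<^sub>R (I u * indicator {..q} (I u))) \<in> borel_measurable lborel" .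
    have "(\<lambda>u. indicator {0<..<\<alpha>} u *\<^sub>R I u) = (\<lambda>u. indicator {0<..<1} u * I u * indicator {..<\<alpha>} u)"
      using \<alpha> by (auto split: split_indicator)
    also have "\<dots> \<in> borel_measurable lborel"
      by (intro borel_measurable_times I_meas) simp
    finally show "(\<lambda>u. indicator {0<..<\<alpha>} u *\<^sub>R I u) \<in> borel_measurable lborel" .
    \<comment> \<open>The two sides can differ only at the single point
      \<open>u = \<alpha>\<close>.\<close>
    show "AE u in lborel. indicator {0<..<1} u *\<^sub>R (I u * indicator {..q} (I u)) = indicator {0<..<\<alpha>} u *\<^sub>R I u"
      using AE_lborel_singleton[of \<alpha>]
    proof eventually_elim
      case (elim u)
      thus ?case
        using pseudoinverse[of u q] q \<alpha> by (auto split: split_indicator)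
    qed
  qed
  also have "\<dots> = (LBINT u=0..\<alpha>. quantile (cdf law) u)"
    using \<alpha> by (simp add: interval_integral_Ioo set_lebesgue_integral_def quantile_def flip: zero_ereal_def)
  finally show ?thesis
    by (simp add: expected_shortfall_def)
qed

text \<open>The integrand is the distance from \<open>t\<close> to \<open>q\<close> when
  \<open>t\<close> lies between \<open>q\<close> and \<open>q0\<close>, and 0 elsewhere. If its
  integral vanished, the density would vanish almost everywhere between \<open>q\<close> and
  \<open>q0\<close>, which positivity near \<open>q0\<close> rules out.\<close>

lemma quantile_gap_integral:
  assumes int: "integrable law (\<lambda>t. t)"
  shows "integrable law (\<lambda>t. (q - t) * (indicator {..q} t - indicator {..q0} t))" (is "integrable law ?T")
    and "0 \<le> (LINT t|law. (q - t) * (indicator {..q} t - indicator {..q0} t))"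
    and "q \<noteq> q0 \<Longrightarrow> 0 < \<epsilon> \<Longrightarrow> (\<And>t. t \<in> ball q0 \<epsilon> \<Longrightarrow> 0 < g t) \<Longrightarrow>
      0 < (LINT t|law. (q - t) * (indicator {..q} t - indicator {..q0} t))"
proof -
  have T_nonneg: "0 \<le> ?T t" for t
    by (auto split: split_indicator)
  have "integrable law (\<lambda>t. q - t)"
    using int by simp
  thus T_int: "integrable law ?T"
    by (rule Bochner_Integration.integrable_bound) (auto split: split_indicator)
  show "0 \<le> (LINT t|law. ?T t)"
    by (intro integral_nonneg_AE AE_I2 T_nonneg)
  assume neq: "q \<noteq> q0" and \<epsilon>: "0 < \<epsilon>" and pos: "\<And>t. t \<in> ball q0 \<epsilon> \<Longrightarrow> 0 < g t"
  show "0 < (LINT t|law. ?T t)"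
  proof (rule ccontr)
    assume "\<not> ?thesis"
    hence "(LINT t|law. ?T t) = 0"
      using \<open>0 \<le> (LINT t|law. ?T t)\<close> by simp
    hence "AE t in law. ?T t = 0"
      using integral_nonneg_eq_0_iff_AE[OF T_int] T_nonneg by simp
    hence zero: "AE t in lborel. 0 < g t \<longrightarrow> ?T t = 0"
      unfolding law_def by (subst (asm) AE_density) auto
    \<comment> \<open>The interval between \<open>q\<close> and \<open>q0\<close>, cut down to the
      \<open>\<epsilon>\<close>-ball around \<open>q0\<close>: there both the integrand and the
      density are positive.\<close>
    define l u where "l = max (min q q0) (q0 - \<epsilon>)" and "u = min (max q q0) (q0 + \<epsilon>)"
    have lu: "l < u"
      using neq \<epsilon> by (auto simp: l_def u_def)
    have "AE t in lborel. t \<notin> {l<..<u}"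
      using zero
    proof eventually_elim
      case (elim t)
      show ?case
      proof
        assume t: "t \<in> {l<..<u}"
        hence "t \<in> ball q0 \<epsilon>"
          by (auto simp: l_def u_def dist_real_def)
        hence "?T t = 0"
          using elim pos by simp
        thus False
          using t by (cases "q < q0") (auto simp: l_def u_def indicator_def)
      qed
    qed
    hence "emeasure lborel {l<..<u} = 0"
      by (subst (asm) AE_iff_measurable[where N = "{l<..<u}"]) auto
    thus False
      using lu by simp
  qed
qed

end

text \<open>A convexity bound: the terms in \<open>G1\<close> and in the identity are of the form \<open>(h q - h y)\<^sup>+\<close>
  with \<open>h\<close> monotone, which is bounded below by \<open>1{y \<le> q0} (h q - h y)\<close>.\<close>

lemma rho_loss_diff_ge:
  fixes x :: "real ^ 'k" and \<theta> \<theta>0 :: "(real ^ 'k) \<times> (real ^ 'k)"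
  assumes \<alpha>: "0 < \<alpha>" and mono: "mono G1"
  defines "q \<equiv> x \<bullet> fst \<theta>" and "e \<equiv> x \<bullet> snd \<theta>" and "q0 \<equiv> x \<bullet> fst \<theta>0" and "e0 \<equiv> x \<bullet> snd \<theta>0"
  shows "rho_loss \<alpha> G1 G2 GG a y x \<theta> - rho_loss \<alpha> G1 G2 GG a y x \<theta>0
    \<ge> (indicator {..q0} y - \<alpha>) * (G1 q - G1 q0)
      + G2 e * (e - q0 + (q0 - y) * indicator {..q0} y / \<alpha> + (q - q0) * (indicator {..q0} y / \<alpha> - 1))
      + G2 e / \<alpha> * ((q - y) * (indicator {..q} y - indicator {..q0} y))
      - G2 e0 * (e0 - q0 + (q0 - y) * indicator {..q0} y / \<alpha>) - GG e + GG e0"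
proof -
  \<comment> \<open>The two sides differ exactly by \<open>G1 q - G1 y\<close> times the difference
    of the indicators of \<open>{..q}\<close> and \<open>{..q0}\<close> at \<open>y\<close>, which
    is nonnegative by monotonicity. The analogous term for the identity function is kept, since it
    later separates \<open>q\<close> from \<open>q0\<close>.\<close>
  have G1: "y \<le> q \<Longrightarrow> G1 y \<le> G1 q" "q \<le> y \<Longrightarrow> G1 q \<le> G1 y"
    using mono by (auto dest: monoD)
  show ?thesis
    unfolding rho_loss_def Let_def q_def[symmetric] e_def[symmetric] q0_def[symmetric] e0_def[symmetric]
    using \<alpha> G1 by (cases "y \<le> q"; cases "y \<le> q0") (auto simp: field_simps)
qed

text \<open>Strict convexity of \<open>GG\<close>: the mean value theorem expresses its increment
  through \<open>G2 z\<close> with \<open>z\<close> strictly between \<open>e\<close> and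
  \<open>e0\<close>, and strict monotonicity compares \<open>G2 z\<close> with
  \<open>G2 e\<close>.\<close>

lemma bregman_pos:
  fixes GG G2 :: "real \<Rightarrow> real"
  assumes deriv: "\<And>x. (GG has_real_derivative G2 x) (at x)" and mono: "strict_mono G2"
  shows "0 \<le> G2 e * (e - e0) + GG e0 - GG e" and "e \<noteq> e0 \<Longrightarrow> 0 < G2 e * (e - e0) + GG e0 - GG e"
proof -
  show pos: "0 < G2 e * (e - e0) + GG e0 - GG e" if "e \<noteq> e0"
  proof (cases "e < e0")
    case True
    then obtain z where z: "e < z" "z < e0" "GG e0 - GG e = (e0 - e) * G2 z"
      using MVT2[of e e0 GG G2] deriv by auto
    have "0 < (e0 - e) * (G2 z - G2 e)"
      using True strict_monoD[OF mono z(1)] by simp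
    thus ?thesis
      using z(3) by (simp add: algebra_simps)
  next
    case False
    with that have "e0 < e"
      by simp
    then obtain z where z: "e0 < z" "z < e" "GG e - GG e0 = (e - e0) * G2 z"
      using MVT2[of e0 e GG G2] deriv by auto
    have "0 < (e - e0) * (G2 e - G2 z)"
      using \<open>e0 < e\<close> strict_monoD[OF mono z(2)] by simp
    thus ?thesis
      using z(3) by (simp add: algebra_simps)
  qed
  show "0 \<le> G2 e * (e - e0) + GG e0 - GG e"
    using pos by (cases "e = e0") auto
qed

text \<open>Integrating the pointwise lower bound against the conditional law leaves the Bregman
  term and the quantile gap term. Both are nonnegative, so \<open>D = 0\<close> forces both to
  vanish: the first then gives equality of the shortfall predictors, the second that of the quantile
  predictors.\<close>

lemma rho_loss_excess:
  fixes x :: "real ^ 'k" and f :: "real ^ 'k \<Rightarrow> real \<Rightarrow> real" and \<theta> \<theta>0 :: "(real ^ 'k) \<times> (real ^ 'k)"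
    and G1 G2 GG a :: "real \<Rightarrow> real" and \<alpha> :: real
  defines "d \<equiv> \<lambda>t. rho_loss \<alpha> G1 G2 GG a t x \<theta> - rho_loss \<alpha> G1 G2 GG a t x \<theta>0"
  defines "D \<equiv> LINT t|lborel. d t * f x t"
  assumes density: "real_density (f x)" and \<alpha>: "0 < \<alpha>" "\<alpha> < 1" and G1_mono: "mono G1"
    and deriv: "\<And>x. (GG has_real_derivative G2 x) (at x)"
    and G2_mono: "strict_mono G2" and G2_pos: "\<And>x. 0 < G2 x"
    and first_moment: "integrable lborel (\<lambda>t. t * f x t)"
    and quantile: "quantile (cond_cdf f x) \<alpha> = x \<bullet> fst \<theta>0"
    and shortfall: "expected_shortfall (cond_cdf f x) \<alpha> = x \<bullet> snd \<theta>0"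
    and density_pos: "0 < \<epsilon>" "\<And>t. t \<in> ball (x \<bullet> fst \<theta>0) \<epsilon> \<Longrightarrow> 0 < f x t"
    and d_meas: "d \<in> borel_measurable borel"
    and d_int: "integrable lborel (\<lambda>t. d t * f x t)"
  shows "0 \<le> D" and "D = 0 \<Longrightarrow> x \<bullet> fst \<theta> = x \<bullet> fst \<theta>0 \<and> x \<bullet> snd \<theta> = x \<bullet> snd \<theta>0"
proof -
  interpret real_density "f x"
    by (rule density)
  have cdf: "cond_cdf f x = cdf law"
    by (rule cond_cdf_eq_cdf_law) simp
  have id_int: "integrable law (\<lambda>t. t)"
    using first_moment by (simp add: integrable_law)
  have loss_int: "integrable law d"
    using d_int by (simp add: integrable_law[OF d_meas])
  have D_eq: "D = (LINT t|law. d t)"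
    by (simp add: D_def integral_law[OF d_meas])
  define q e q0 e0 where "q = x \<bullet> fst \<theta>" and "e = x \<bullet> snd \<theta>" and "q0 = x \<bullet> fst \<theta>0" and "e0 = x \<bullet> snd \<theta>0"
  define J :: "real \<Rightarrow> real" where "J = indicator {..q0}"
  define T where "T = (\<lambda>t. (q - t) * (indicator {..q} t - indicator {..q0} t))"
  have cdf_q0: "cdf law q0 = \<alpha>"
    using cdf_quantile[OF \<alpha> quantile[unfolded cdf]] by (simp add: q0_def)
  have J_int: "integrable law J"
    by (simp add: J_def integrable_indicator_iff less_top[symmetric])
  have J_mean: "(LINT t|law. J t) = \<alpha>"
    using cdf_q0 by (simp add: J_def cdf_def)
  have tJ_int: "integrable law (\<lambda>t. t * J t)"
    unfolding J_def by (rule Bochner_Integration.integrable_bound[OF id_int]) (auto split: split_indicator)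
  \<comment> \<open>The shortfall part of the model enters here, as a statement about the mean below
    the quantile.\<close>
  have tJ_mean: "(LINT t|law. t * J t) = \<alpha> * e0"
    using expected_shortfall_eq_tail_mean[OF \<alpha> cdf_q0] shortfall \<alpha> by (simp add: J_def e0_def cdf field_simps)
  have T_int: "integrable law T"
    unfolding T_def by (rule quantile_gap_integral(1)[OF id_int])
  let ?lower = "\<lambda>t. (J t - \<alpha>) * (G1 q - G1 q0)
      + G2 e * (e - q0 + (q0 - t) * J t / \<alpha> + (q - q0) * (J t / \<alpha> - 1))
      + G2 e / \<alpha> * T t - G2 e0 * (e0 - q0 + (q0 - t) * J t / \<alpha>) - GG e + GG e0"
  \<comment> \<open>As a function of \<open>t\<close>, the lower bound is a combination of
    \<open>1\<close>, \<open>J\<close>, \<open>t * J t\<close> and \<open>T\<close>; the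
    abbreviations collect the first three coefficients.\<close>
  let ?c = "- \<alpha> * (G1 q - G1 q0) + G2 e * (e - q) - G2 e0 * (e0 - q0) - GG e + GG e0"
  let ?d = "G1 q - G1 q0 + G2 e * q / \<alpha> - G2 e0 * q0 / \<alpha>"
  let ?l = "(G2 e0 - G2 e) / \<alpha>"
  have lower_eq: "?lower t = ?c + ?d * J t + ?l * (t * J t) + G2 e / \<alpha> * T t" for t
    using \<alpha> by (simp add: field_simps)
  have lower_int: "integrable law ?lower"
    unfolding lower_eq by (intro Bochner_Integration.integrable_add integrable_mult_right J_int tJ_int T_int integrable_const)
  have "(LINT t|law. ?lower t) = ?c + ?d * \<alpha> + ?l * (\<alpha> * e0) + G2 e / \<alpha> * (LINT t|law. T t)"
    unfolding lower_eq using J_int tJ_int T_int J_mean tJ_mean prob_space by simp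
  \<comment> \<open>Because \<open>J\<close> has mean exactly \<open>\<alpha>\<close>, all terms in
    \<open>G1\<close> cancel, and so do the contributions of \<open>q\<close> and \<open>q0\<close>
    outside \<open>T\<close>.\<close>
  also have "\<dots> = (G2 e * (e - e0) + GG e0 - GG e) + G2 e / \<alpha> * (LINT t|law. T t)"
    using \<alpha> by (simp add: field_simps)
  finally have lower: "D \<ge> (G2 e * (e - e0) + GG e0 - GG e) + G2 e / \<alpha> * (LINT t|law. T t)"
    using integral_mono[OF lower_int loss_int] rho_loss_diff_ge[OF \<alpha>(1) G1_mono, where x = x]
    by (simp add: D_eq d_def J_def T_def q_def q0_def e_def e0_def)
  have T_nonneg: "0 \<le> G2 e / \<alpha> * (LINT t|law. T t)"
    using quantile_gap_integral(2)[OF id_int] \<alpha> G2_pos[of e] by (simp add: T_def)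
  show "0 \<le> D"
    using lower T_nonneg bregman_pos(1)[OF deriv G2_mono, of e e0] by linarith
  assume "D = 0"
  have "e = e0"
    using lower T_nonneg bregman_pos(2)[OF deriv G2_mono, of e e0] \<open>D = 0\<close> by linarith
  moreover have "q = q0"
  proof (rule ccontr)
    assume "q \<noteq> q0"
    hence "0 < (LINT t|law. T t)"
      unfolding T_def using density_pos by (intro quantile_gap_integral(3)[OF id_int]) (auto simp: q0_def)
    hence "0 < G2 e / \<alpha> * (LINT t|law. T t)"
      using \<alpha> G2_pos[of e] by simp
    thus False
      using lower bregman_pos(1)[OF deriv G2_mono, of e e0] \<open>D = 0\<close> by linarith
  qed
  ultimately show "x \<bullet> fst \<theta> = x \<bullet> fst \<theta>0 \<and> x \<bullet> snd \<theta> = x \<bullet> snd \<theta>0"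
    by (simp add: q_def q0_def e_def e0_def)
qed

section \<open>Disintegration along a conditional density\<close>

text \<open>The condition \<open>f_cond\<close> describes the joint law only on products of a Borel
  set and a half-line. The results below extend it to integrals of arbitrary Borel functions of
  \<open>X\<close> and \<open>Y\<close>.\<close>

locale conditional_density = prob_space M
  for M :: "'a measure" and X :: "'a \<Rightarrow> 'x :: second_countable_topology" and Y :: "'a \<Rightarrow> real"
    and f :: "'x \<Rightarrow> real \<Rightarrow> real" +
  assumes X_rv [measurable]: "X \<in> borel_measurable M" and Y_rv [measurable]: "Y \<in> borel_measurable M"
    and f_meas: "(\<lambda>(x, t). f x t) \<in> borel_measurable borel"
    and f_nonneg: "\<And>x t. 0 \<le> f x t"
    and f_int: "\<And>x. integrable lborel (f x)"
    and f_one: "\<And>x. (LINT t|lborel. f x t) = 1"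
    and f_cond: "\<And>y B. B \<in> sets borel \<Longrightarrow>
        measure M {\<omega> \<in> space M. Y \<omega> \<le> y \<and> X \<omega> \<in> B}
          = (LINT \<omega>|M. indicator B (X \<omega>) * cond_cdf f (X \<omega>) y)"
begin

interpretation X: prob_space "distr M borel X" by (rule prob_space_distr) simp

interpretation X_lborel: pair_sigma_finite "distr M borel X" lborel ..

abbreviation (input) "product_law \<equiv> density (distr M borel X \<Otimes>\<^sub>M lborel) (\<lambda>(x, t). ennreal (f x t))"

abbreviation (input) "joint_law \<equiv> distr M borel (\<lambda>\<omega>. (X \<omega>, Y \<omega>))"

lemma sets_distr_lborel: "sets (distr M borel X \<Otimes>\<^sub>M lborel) = sets (borel \<Otimes>\<^sub>M borel)"
  by (rule sets_pair_measure_cong) auto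

lemma measurable_density:
  "(\<lambda>(x, t). f x t) \<in> borel_measurable (borel \<Otimes>\<^sub>M borel)"
  using f_meas by (simp only: borel_prod)

lemma sets_joint_law: "sets joint_law = sets (borel \<Otimes>\<^sub>M borel)"
  by (simp only: borel_prod sets_distr)

text \<open>By Tonelli, integrating over \<open>t\<close> first turns the density into the
  conditional distribution function, and the remaining mean over \<open>X\<close> is the probability
  given by \<open>f_cond\<close>.\<close>

lemma product_law_rectangle:
  assumes [measurable]: "B \<in> sets borel"
  shows "emeasure product_law (B \<times> {..y}) = emeasure joint_law (B \<times> {..y})"
proof -
  note [measurable] = measurable_density
  have ind_int: "integrable lborel (\<lambda>t. indicator {..y} t * f x t)" for x
    using integrable_real_mult_indicator[OF _ f_int[of x], of "{..y}"] by (simp add: mult.commute)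
  have cdf: "(\<integral>\<^sup>+t. (case (x, t) of (x, t) \<Rightarrow> ennreal (f x t)) * indicator (B \<times> {..y}) (x, t) \<partial>lborel)
      = ennreal (indicator B x * cond_cdf f x y)" for x
  proof -
    have "(\<integral>\<^sup>+t. (case (x, t) of (x, t) \<Rightarrow> ennreal (f x t)) * indicator (B \<times> {..y}) (x, t) \<partial>lborel)
        = (\<integral>\<^sup>+t. ennreal (indicator B x * (indicator {..y} t * f x t)) \<partial>lborel)"
      by (intro nn_integral_cong) (auto split: split_indicator)
    also have "\<dots> = ennreal (LINT t|lborel. indicator B x * (indicator {..y} t * f x t))"
      using ind_int f_nonneg by (intro nn_integral_eq_integral integrable_mult_right) auto
    finally show ?thesis
      by (simp add: cond_cdf_def)
  qed
  have cdf_meas [measurable]: "(\<lambda>x. cond_cdf f x y) \<in> borel_measurable borel"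
    unfolding cond_cdf_def by measurable
  \<comment> \<open>Together with the upper bound 1, this makes the function of \<open>X\<close>
    integrable, so that its nonnegative integral can be read as the real integral in
    \<open>f_cond\<close>.\<close>
  have cdf_nonneg: "0 \<le> cond_cdf f x y" for x
    unfolding cond_cdf_def using f_nonneg by (intro integral_nonneg_AE AE_I2) auto
  have "cond_cdf f x y \<le> (LINT t|lborel. f x t)" for x
    unfolding cond_cdf_def using f_nonneg f_int[of x] ind_int[of x]
    by (intro integral_mono) (auto split: split_indicator)
  hence cdf_le_one: "cond_cdf f x y \<le> 1" for x
    by (simp add: f_one)
  have rect: "B \<times> {..y} \<in> sets (distr M borel X \<Otimes>\<^sub>M lborel)"
    by (rule pair_measureI) auto
  have "emeasure product_law (B \<times> {..y})
      = (\<integral>\<^sup>+z. (case z of (x, t) \<Rightarrow> ennreal (f x t)) * indicator (B \<times> {..y}) z \<partial>(distr M borel X \<Otimes>\<^sub>M lborel))"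
    by (rule emeasure_density[OF _ rect]) measurable
  also have "\<dots> = (\<integral>\<^sup>+x. ennreal (indicator B x * cond_cdf f x y) \<partial>distr M borel X)"
    by (subst lborel.nn_integral_fst[symmetric]) (use rect in \<open>measurable, simp only: cdf\<close>)
  also have "\<dots> = (\<integral>\<^sup>+\<omega>. ennreal (indicator B (X \<omega>) * cond_cdf f (X \<omega>) y) \<partial>M)"
    by (rule nn_integral_distr) measurable
  also have "\<dots> = ennreal (LINT \<omega>|M. indicator B (X \<omega>) * cond_cdf f (X \<omega>) y)"
    using cdf_nonneg cdf_le_one
    by (intro nn_integral_eq_integral integrable_const_bound[where B = 1] AE_I2)
       (auto split: split_indicator)
  also have "\<dots> = ennreal (measure M {\<omega> \<in> space M. Y \<omega> \<le> y \<and> X \<omega> \<in> B})"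
    by (simp add: f_cond)
  also have "\<dots> = emeasure joint_law (B \<times> {..y})"
  proof -
    have "B \<times> {..y} \<in> sets borel"
      using rect by (simp only: sets_distr_lborel borel_prod)
    moreover have "(\<lambda>\<omega>. (X \<omega>, Y \<omega>)) -` (B \<times> {..y}) \<inter> space M = {\<omega> \<in> space M. Y \<omega> \<le> y \<and> X \<omega> \<in> B}"
      by auto
    ultimately show ?thesis
      by (simp add: emeasure_distr emeasure_eq_measure)
  qed
  finally show ?thesis .
qed

lemma emeasure_product_law_UNIV: "emeasure product_law UNIV = 1"
proof -
  note [measurable] = measurable_density
  have "(\<integral>\<^sup>+t. ennreal (f x t) \<partial>lborel) = ennreal (LINT t|lborel. f x t)" for x
    using f_int f_nonneg by (intro nn_integral_eq_integral) auto
  hence one: "(\<integral>\<^sup>+t. (case (x, t) of (x, t) \<Rightarrow> ennreal (f x t)) \<partial>lborel) = 1" for x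
    by (simp add: f_one)
  have meas: "(\<lambda>(x, t). ennreal (f x t)) \<in> borel_measurable (distr M borel X \<Otimes>\<^sub>M lborel)"
    unfolding measurable_cong_sets[OF sets_distr_lborel refl] by measurable
  have "emeasure product_law (space (distr M borel X \<Otimes>\<^sub>M lborel))
      = (\<integral>\<^sup>+z. (case z of (x, t) \<Rightarrow> ennreal (f x t)) \<partial>(distr M borel X \<Otimes>\<^sub>M lborel))"
    by (subst emeasure_density[OF meas sets.top]) (auto intro: nn_integral_cong)
  also have "\<dots> = (\<integral>\<^sup>+x. 1 \<partial>distr M borel X)"
    by (subst lborel.nn_integral_fst[OF meas, symmetric]) (simp only: one)
  also have "\<dots> = 1"
    using X.emeasure_space_1 by simp
  finally show ?thesis
    by (simp add: space_pair_measure)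
qed

text \<open>Two extensions are made. For fixed \<open>B\<close>, uniqueness of distribution
  functions passes from half-lines to all Borel sets in the second coordinate; then the rectangles
  form an intersection-stable generator of the product sigma-algebra.\<close>

lemma joint_law_eq_product_law: "joint_law = product_law"
proof -
  have sets_product: "sets product_law = sets (borel \<Otimes>\<^sub>M borel)"
    by (simp only: sets_density sets_distr_lborel)
  have UNIV_joint: "emeasure joint_law UNIV = 1"
    using prob_space.emeasure_space_1[OF prob_space_distr, of "\<lambda>\<omega>. (X \<omega>, Y \<omega>)" borel] by simp
  have rectangle: "emeasure joint_law (B \<times> A) = emeasure product_law (B \<times> A)"
    if B [measurable]: "B \<in> sets borel" and A: "A \<in> sets borel" for A B
  proof -
    \<comment> \<open>The measure on the line that sends \<open>A\<close> to the
      \<open>N\<close>-measure of \<open>B \<times> A\<close>.\<close>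
    let ?slice = "\<lambda>N. distr (density N (indicator (B \<times> UNIV))) borel snd"
    have slice: "emeasure (?slice N) A = emeasure N (B \<times> A)"
      if N: "sets N = sets (borel \<Otimes>\<^sub>M borel)" and A [measurable]: "A \<in> sets borel" for N :: "('x \<times> real) measure" and A
    proof -
      have [measurable_cong]: "sets N = sets (borel \<Otimes>\<^sub>M borel)"
        by (rule N)
      have sp: "space N = UNIV"
        using sets_eq_imp_space_eq[OF N] by (simp add: space_pair_measure)
      have "snd -` A \<inter> space N = UNIV \<times> A"
        by (auto simp: sp)
      hence "emeasure (?slice N) A = emeasure (density N (indicator (B \<times> UNIV))) (UNIV \<times> A)"
        by (subst emeasure_distr) simp_all
      also have "\<dots> = (\<integral>\<^sup>+z. indicator (B \<times> UNIV) z * indicator (UNIV \<times> A) z \<partial>N)"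
        by (rule emeasure_density) measurable
      also have "\<dots> = (\<integral>\<^sup>+z. indicator (B \<times> A) z \<partial>N)"
        by (intro nn_integral_cong) (auto split: split_indicator)
      also have "\<dots> = emeasure N (B \<times> A)"
        by (rule nn_integral_indicator) measurable
      finally show ?thesis .
    qed
    \<comment> \<open>A slice has the mass of \<open>B \<times> UNIV\<close>, which may be less than
      1, so uniqueness is applied to finite measures and not to probability measures.\<close>
    have finite: "finite_borel_measure (?slice N)"
      if N: "sets N = sets (borel \<Otimes>\<^sub>M borel)" and one: "emeasure N UNIV = 1" for N :: "('x \<times> real) measure"
    proof -
      have "emeasure (?slice N) UNIV \<le> emeasure N UNIV"
        using slice[OF N, of UNIV] sets_eq_imp_space_eq[OF N] emeasure_space[of N "B \<times> UNIV"]
        by (simp add: space_pair_measure)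
      hence "emeasure (?slice N) UNIV \<noteq> \<infinity>"
        by (auto simp: one top_unique)
      thus ?thesis
        by (intro finite_borel_measure.intro finite_measureI finite_borel_measure_axioms.intro) simp_all
    qed
    have "emeasure (?slice joint_law) {..y} = emeasure (?slice product_law) {..y}" for y
      by (simp only: slice[OF sets_joint_law atMost_borel] slice[OF sets_product atMost_borel] product_law_rectangle[OF B])
    hence "cdf (?slice joint_law) = cdf (?slice product_law)"
      by (intro ext) (simp only: cdf_def measure_def)
    hence "?slice joint_law = ?slice product_law"
      by (intro cdf_unique' finite sets_joint_law sets_product UNIV_joint emeasure_product_law_UNIV)
    thus ?thesis
      using slice[OF sets_joint_law A] slice[OF sets_product A] by simp
  qed
  show ?thesis
  proof (rule measure_eqI_generator_eq[OF Int_stable_pair_measure_generator[of borel borel], where \<Omega> = "UNIV \<times> UNIV" and A = "\<lambda>_. UNIV \<times> UNIV"])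
    show "sets joint_law = sigma_sets (UNIV \<times> UNIV) {a \<times> b |a b. a \<in> sets borel \<and> b \<in> sets borel}"
      by (subst sets_joint_law) (simp add: sets_pair_measure)
    show "sets product_law = sigma_sets (UNIV \<times> UNIV) {a \<times> b |a b. a \<in> sets borel \<and> b \<in> sets borel}"
      by (subst sets_product) (simp add: sets_pair_measure)
    show "emeasure joint_law (UNIV \<times> UNIV) \<noteq> \<infinity>" for i :: nat
      using UNIV_joint by simp
    show "range (\<lambda>_ :: nat. UNIV \<times> UNIV) \<subseteq> {a \<times> b |a b. a \<in> sets (borel :: 'x measure) \<and> b \<in> sets (borel :: real measure)}"
      by (rule image_subsetI, rule CollectI, rule exI[of _ UNIV], rule exI[of _ UNIV]) simp
    show "emeasure joint_law S = emeasure product_law S"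
      if "S \<in> {a \<times> b |a b. a \<in> sets borel \<and> b \<in> sets borel}" for S
    proof -
      from that obtain A B where "S = B \<times> A" "B \<in> sets borel" "A \<in> sets borel"
        by blast
      thus ?thesis
        by (simp only: rectangle)
    qed
  qed auto
qed

text \<open>The nonnegative version serves to establish integrability in the first place, before the
  Bochner version can be applied.\<close>

lemma nn_integral_disintegration:
  assumes h: "h \<in> borel_measurable (borel \<Otimes>\<^sub>M borel)"
  shows "(\<integral>\<^sup>+\<omega>. h (X \<omega>, Y \<omega>) \<partial>M) = (\<integral>\<^sup>+\<omega>. (\<integral>\<^sup>+t. ennreal (f (X \<omega>) t) * h (X \<omega>, t) \<partial>lborel) \<partial>M)"
proof -
  note [measurable] = h measurable_density
  have [measurable_cong]: "sets (distr M borel X \<Otimes>\<^sub>M lborel) = sets (borel \<Otimes>\<^sub>M borel)"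
    by (rule sets_distr_lborel)
  have "(\<integral>\<^sup>+\<omega>. h (X \<omega>, Y \<omega>) \<partial>M) = (\<integral>\<^sup>+z. h z \<partial>joint_law)"
    using h by (intro nn_integral_distr[symmetric]) (auto simp: borel_prod)
  also have "\<dots> = (\<integral>\<^sup>+z. (case z of (x, t) \<Rightarrow> ennreal (f x t)) * h z \<partial>(distr M borel X \<Otimes>\<^sub>M lborel))"
    unfolding joint_law_eq_product_law by (rule nn_integral_density) measurable
  also have "\<dots> = (\<integral>\<^sup>+x. (\<integral>\<^sup>+t. ennreal (f x t) * h (x, t) \<partial>lborel) \<partial>distr M borel X)"
    by (subst lborel.nn_integral_fst[symmetric]) simp_all
  also have "\<dots> = (\<integral>\<^sup>+\<omega>. (\<integral>\<^sup>+t. ennreal (f (X \<omega>) t) * h (X \<omega>, t) \<partial>lborel) \<partial>M)"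
    by (rule nn_integral_distr) measurable
  finally show ?thesis .
qed

text \<open>Fubini's theorem under the product law. The inner integrand is guaranteed integrable
  only for almost every value of \<open>X\<close>.\<close>

lemma integral_disintegration:
  fixes h :: "'x \<times> real \<Rightarrow> real"
  assumes h: "h \<in> borel_measurable (borel \<Otimes>\<^sub>M borel)" and int: "integrable M (\<lambda>\<omega>. h (X \<omega>, Y \<omega>))"
  shows "AE \<omega> in M. integrable lborel (\<lambda>t. h (X \<omega>, t) * f (X \<omega>) t)"
    and "integrable M (\<lambda>\<omega>. LINT t|lborel. h (X \<omega>, t) * f (X \<omega>) t)"
    and "(LINT \<omega>|M. h (X \<omega>, Y \<omega>)) = (LINT \<omega>|M. LINT t|lborel. h (X \<omega>, t) * f (X \<omega>) t)"
proof -
  note [measurable] = h measurable_density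
  have [measurable_cong]: "sets (distr M borel X \<Otimes>\<^sub>M lborel) = sets (borel \<Otimes>\<^sub>M borel)"
    by (rule sets_distr_lborel)
  \<comment> \<open>Moving \<open>ennreal\<close> outermost gives the density the shape required by
    the integral rules for real-valued densities.\<close>
  have density_eq: "product_law = density (distr M borel X \<Otimes>\<^sub>M lborel) (\<lambda>z. ennreal (case z of (x, t) \<Rightarrow> f x t))"
    by (simp add: case_prod_unfold)
  have h_borel: "h \<in> borel_measurable borel" and pair: "(\<lambda>\<omega>. (X \<omega>, Y \<omega>)) \<in> measurable M borel"
    using h by (auto simp: borel_prod)
  let ?k = "\<lambda>z. (case z of (x, t) \<Rightarrow> f x t) *\<^sub>R h z"
  have k_int: "integrable (distr M borel X \<Otimes>\<^sub>M lborel) ?k"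
  proof -
    have "integrable product_law h"
      unfolding joint_law_eq_product_law[symmetric] using int h_borel pair by (simp add: integrable_distr_eq)
    thus ?thesis
      unfolding density_eq by (subst (asm) integrable_density) (auto simp: f_nonneg)
  qed
  have "AE x in distr M borel X. integrable lborel (\<lambda>t. h (x, t) * f x t)"
    using X_lborel.AE_integrable_fst'[OF k_int] by (simp add: mult.commute)
  thus "AE \<omega> in M. integrable lborel (\<lambda>t. h (X \<omega>, t) * f (X \<omega>) t)"
    by (rule AE_distrD[OF X_rv])
  have inner: "integrable (distr M borel X) (\<lambda>x. LINT t|lborel. h (x, t) * f x t)"
    using X_lborel.integrable_fst'[OF k_int] by (simp add: mult.commute)
  thus "integrable M (\<lambda>\<omega>. LINT t|lborel. h (X \<omega>, t) * f (X \<omega>) t)"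
    by (rule integrable_distr[OF X_rv])
  have "(LINT \<omega>|M. h (X \<omega>, Y \<omega>)) = (LINT z|joint_law. h z)"
    using h_borel pair by (simp add: integral_distr)
  also have "\<dots> = (LINT z|(distr M borel X \<Otimes>\<^sub>M lborel). ?k z)"
    unfolding joint_law_eq_product_law density_eq by (rule integral_density) (auto simp: f_nonneg)
  also have "\<dots> = (LINT x|distr M borel X. LINT t|lborel. h (x, t) * f x t)"
    using X_lborel.integral_fst'[OF k_int] by (simp add: mult.commute)
  also have "\<dots> = (LINT \<omega>|M. LINT t|lborel. h (X \<omega>, t) * f (X \<omega>) t)"
    using inner by (intro integral_distr) auto
  finally show "(LINT \<omega>|M. h (X \<omega>, Y \<omega>)) = (LINT \<omega>|M. LINT t|lborel. h (X \<omega>, t) * f (X \<omega>) t)" .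
qed

end

section \<open>Wald consistency\<close>

text \<open>The infima of the loss over shrinking balls around \<open>\<theta>\<close> converge to
  the loss at \<open>\<theta>\<close> by continuity. Dominated convergence with the envelope
  \<open>B\<close> carries this over to the means, which eventually exceed \<open>c\<close>.\<close>

lemma expectation_local_infimum:
  fixes V :: "'a \<Rightarrow> 'v :: second_countable_topology"
    and \<rho> :: "'v \<Rightarrow> 'p :: {metric_space, second_countable_topology} \<Rightarrow> real"
  assumes V [measurable]: "V \<in> borel_measurable M"
    and compact: "compact \<Theta>" and \<theta>: "\<theta> \<in> \<Theta>"
    and cont: "\<And>v. continuous_on \<Theta> (\<rho> v)"
    and meas: "\<And>\<theta>. \<theta> \<in> \<Theta> \<Longrightarrow> (\<lambda>v. \<rho> v \<theta>) \<in> borel_measurable borel"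
    and B: "integrable M B" and dom: "\<And>\<omega> \<theta>. \<omega> \<in> space M \<Longrightarrow> \<theta> \<in> \<Theta> \<Longrightarrow> \<bar>\<rho> (V \<omega>) \<theta>\<bar> \<le> B \<omega>"
    and c: "c < (LINT \<omega>|M. \<rho> (V \<omega>) \<theta>)"
  shows "\<exists>r h. 0 < r \<and> h \<in> borel_measurable borel
      \<and> (\<forall>v. \<forall>\<theta>'\<in>\<Theta>. dist \<theta> \<theta>' < r \<longrightarrow> h v \<le> \<rho> v \<theta>')
      \<and> integrable M (\<lambda>\<omega>. h (V \<omega>)) \<and> c < (LINT \<omega>|M. h (V \<omega>))"
proof -
  obtain D where D: "countable D" "D \<subseteq> \<Theta>" "\<Theta> \<subseteq> closure D"
    using separable by blast
  \<comment> \<open>Infima over countable sets are Borel measurable. The radius uses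
    \<open>Suc n\<close> so that it is positive for every \<open>n\<close>.\<close>
  define Dn where "Dn = (\<lambda>n. D \<inter> ball \<theta> (1 / real (Suc n)))"
  define h where "h = (\<lambda>n v. INF \<theta>'\<in>Dn n. \<rho> v \<theta>')"
  \<comment> \<open>Since the ball is open, cutting \<open>D\<close> down to it preserves density
    inside the ball.\<close>
  have dense: "\<Theta> \<inter> ball \<theta> (1 / real (Suc n)) \<subseteq> closure (Dn n)" for n
    using open_Int_closure_subset[of "ball \<theta> (1 / real (Suc n))" D] D(3) by (auto simp: Dn_def Int_commute)
  have \<theta>_closure: "\<theta> \<in> closure (Dn n)" for n
    using dense[of n] \<theta> by auto
  hence ne: "Dn n \<noteq> {}" for n
    by (metis closure_empty empty_iff)
  have closure_le: "closure (Dn n) \<subseteq> \<Theta>" for n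
    using D(2) compact_imp_closed[OF compact] by (intro closure_minimal) (auto simp: Dn_def)
  have bdd: "bdd_below (\<rho> v ` Dn n)" for v n
  proof -
    have "bdd_below (\<rho> v ` \<Theta>)"
      by (intro bounded_imp_bdd_below compact_imp_bounded compact_continuous_image cont compact)
    thus ?thesis
      by (rule bdd_below_mono) (use D(2) in \<open>auto simp: Dn_def\<close>)
  qed
  \<comment> \<open>The lower bound on the countable set extends to every parameter of
    \<open>\<Theta>\<close> in the ball by continuity of the loss.\<close>
  have h_le: "h n v \<le> \<rho> v \<theta>'" if "\<theta>' \<in> \<Theta>" "dist \<theta> \<theta>' < 1 / real (Suc n)" for n v \<theta>'
  proof (rule continuous_ge_on_closure[of "Dn n" "\<rho> v" \<theta>' "h n v"])
    show "continuous_on (closure (Dn n)) (\<rho> v)"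
      using cont closure_le by (rule continuous_on_subset)
    show "\<theta>' \<in> closure (Dn n)"
      using dense[of n] that by auto
    show "h n v \<le> \<rho> v x" if "x \<in> Dn n" for x
      unfolding h_def using bdd that by (rule cINF_lower)
  qed
  have h_meas: "h n \<in> borel_measurable borel" for n
    unfolding h_def using D meas by (intro borel_measurable_cINF_real) (auto simp: Dn_def)
  have h_dom: "\<bar>h n (V \<omega>)\<bar> \<le> B \<omega>" if \<omega>: "\<omega> \<in> space M" for n \<omega>
  proof -
    have "h n (V \<omega>) \<le> B \<omega>"
      using h_le[OF \<theta>, of n "V \<omega>"] dom[OF \<omega> \<theta>] by simp
    moreover have "- B \<omega> \<le> h n (V \<omega>)"
      unfolding h_def
    proof (rule cINF_greatest[OF ne])
      show "- B \<omega> \<le> \<rho> (V \<omega>) x" if "x \<in> Dn n" for x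
        using dom[OF \<omega>, of x] that D(2) by (auto simp: Dn_def)
    qed
    ultimately show ?thesis
      by simp
  qed
  have h_lim: "(\<lambda>n. h n v) \<longlonglongrightarrow> \<rho> v \<theta>" for v
  proof (rule tendstoI)
    fix \<delta> :: real
    assume "0 < \<delta>"
    then obtain r where r: "0 < r" and near: "\<And>x. x \<in> \<Theta> \<Longrightarrow> dist x \<theta> < r \<Longrightarrow> dist (\<rho> v x) (\<rho> v \<theta>) < \<delta> / 2"
      using cont[of v] \<theta> unfolding continuous_on_iff by (meson half_gt_zero)
    have "\<forall>\<^sub>F n in sequentially. 1 / real (Suc n) < r"
      using LIMSEQ_inverse_real_of_nat r by (intro order_tendstoD(2)) (auto simp: inverse_eq_divide)
    thus "\<forall>\<^sub>F n in sequentially. dist (h n v) (\<rho> v \<theta>) < \<delta>"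
    proof eventually_elim
      case (elim n)
      have "\<rho> v \<theta> - \<delta> / 2 \<le> h n v"
        unfolding h_def
      proof (rule cINF_greatest[OF ne])
        fix x
        assume x: "x \<in> Dn n"
        hence "dist x \<theta> < r"
          using elim by (auto simp: Dn_def dist_commute)
        hence "\<bar>\<rho> v x - \<rho> v \<theta>\<bar> < \<delta> / 2"
          using near[of x] x D(2) by (auto simp: Dn_def dist_real_def)
        thus "\<rho> v \<theta> - \<delta> / 2 \<le> \<rho> v x"
          by linarith
      qed
      moreover have "h n v \<le> \<rho> v \<theta>"
        using h_le[OF \<theta>] by simp
      ultimately show ?case
        using \<open>0 < \<delta>\<close> by (simp add: dist_real_def)
    qed
  qed
  have h_int: "integrable M (\<lambda>\<omega>. h n (V \<omega>))" for n
  proof (rule Bochner_Integration.integrable_bound[OF B measurable_compose[OF V h_meas]])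
    show "AE \<omega> in M. norm (h n (V \<omega>)) \<le> norm (B \<omega>)"
      using h_dom by (intro AE_I2) (metis abs_ge_self order_trans real_norm_def)
  qed
  have "(\<lambda>n. LINT \<omega>|M. h n (V \<omega>)) \<longlonglongrightarrow> (LINT \<omega>|M. \<rho> (V \<omega>) \<theta>)"
    using B
  proof (rule integral_dominated_convergence[rotated 2])
    show "(\<lambda>\<omega>. \<rho> (V \<omega>) \<theta>) \<in> borel_measurable M"
      by (rule measurable_compose[OF V meas[OF \<theta>]])
    show "(\<lambda>\<omega>. h n (V \<omega>)) \<in> borel_measurable M" for n
      by (rule measurable_compose[OF V h_meas])
  qed (use h_lim h_dom in auto)
  hence "\<forall>\<^sub>F n in sequentially. c < (LINT \<omega>|M. h n (V \<omega>))"
    using c by (rule order_tendstoD(1))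
  then obtain n where "c < (LINT \<omega>|M. h n (V \<omega>))"
    using eventually_happens'[OF sequentially_bot] by blast
  thus ?thesis
    using h_le h_meas h_int by (intro exI[of _ "1 / real (Suc n)"] exI[of _ "h n"]) auto
qed

text \<open>An estimate outside the ball around \<open>\<theta>0\<close> falls into one of finitely
  many neighbourhoods. There the average of the local infimum is at most the average loss at
  \<open>\<theta>0\<close> plus the remainder, although their limits are strictly ordered the other
  way; hence some average, or the remainder, is far from its limit.\<close>

lemma wald_consistency:
  fixes V :: "'a \<Rightarrow> 'v :: second_countable_topology"
    and \<rho> :: "'v \<Rightarrow> 'p :: {metric_space, second_countable_topology} \<Rightarrow> real"
  assumes prob: "prob_space M"
    and V [measurable]: "V \<in> borel_measurable M"
    and Vs_indep: "prob_space.indep_vars M (\<lambda>_. borel) Vs UNIV"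
    and Vs_distr: "\<And>i :: nat. distr M borel (Vs i) = distr M borel V"
    and compact: "compact \<Theta>" and \<theta>0: "\<theta>0 \<in> \<Theta>"
    and cont: "\<And>v. continuous_on \<Theta> (\<rho> v)"
    and meas: "\<And>\<theta>. \<theta> \<in> \<Theta> \<Longrightarrow> (\<lambda>v. \<rho> v \<theta>) \<in> borel_measurable borel"
    and B: "integrable M B" and dom: "\<And>\<omega> \<theta>. \<omega> \<in> space M \<Longrightarrow> \<theta> \<in> \<Theta> \<Longrightarrow> \<bar>\<rho> (V \<omega>) \<theta>\<bar> \<le> B \<omega>"
    and ident: "\<And>\<theta>. \<theta> \<in> \<Theta> \<Longrightarrow> \<theta> \<noteq> \<theta>0 \<Longrightarrow> (LINT \<omega>|M. \<rho> (V \<omega>) \<theta>0) < (LINT \<omega>|M. \<rho> (V \<omega>) \<theta>)"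
    and est_in: "\<And>n \<omega>. \<omega> \<in> space M \<Longrightarrow> \<theta>hat n \<omega> \<in> \<Theta>"
    and R_meas [measurable]: "\<And>n. R n \<in> borel_measurable M" and R: "conv_in_prob M R 0"
    and est_min: "\<And>n \<omega>. \<omega> \<in> space M \<Longrightarrow>
        (1 / real n) * (\<Sum>i<n. \<rho> (Vs i \<omega>) (\<theta>hat n \<omega>)) \<le> (1 / real n) * (\<Sum>i<n. \<rho> (Vs i \<omega>) \<theta>0) + R n \<omega>"
  shows "conv_in_prob M \<theta>hat \<theta>0"
  unfolding conv_in_prob_def
proof (intro allI impI)
  interpret prob_space M by (rule prob)
  fix \<epsilon> :: real
  assume \<epsilon>: "0 < \<epsilon>"
  have Vs [measurable]: "Vs i \<in> borel_measurable M" for i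
    using Vs_indep by (auto simp: indep_vars_def)
  have lln: "conv_in_prob M (\<lambda>n \<omega>. 1 / real n * (\<Sum>i<n. h (Vs i \<omega>))) (expectation (\<lambda>\<omega>. h (V \<omega>)))"
    if h [measurable]: "h \<in> borel_measurable borel" and int: "integrable M (\<lambda>\<omega>. h (V \<omega>))" for h
  proof (rule weak_law_of_large_numbers[OF _ _ int])
    show "indep_vars (\<lambda>_. borel) (\<lambda>i \<omega>. h (Vs i \<omega>)) UNIV"
      by (rule indep_vars_compose2[OF Vs_indep]) simp
    have "distr M borel (\<lambda>\<omega>. h (W \<omega>)) = distr (distr M borel W) borel h" if "W \<in> borel_measurable M" for W
      using that by (simp add: distr_distr comp_def)
    thus "distr M borel (\<lambda>\<omega>. h (Vs i \<omega>)) = distr M borel (\<lambda>\<omega>. h (V \<omega>))" for i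
      by (simp add: Vs_distr)
  qed
  define c where "c = expectation (\<lambda>\<omega>. \<rho> (V \<omega>) \<theta>0)"
  have c_int: "integrable M (\<lambda>\<omega>. \<rho> (V \<omega>) \<theta>0)"
  proof (rule Bochner_Integration.integrable_bound[OF B measurable_compose[OF V meas[OF \<theta>0]]])
    show "AE \<omega> in M. norm (\<rho> (V \<omega>) \<theta>0) \<le> norm (B \<omega>)"
      using dom[OF _ \<theta>0] by (intro AE_I2) (metis abs_ge_self order_trans real_norm_def)
  qed
  define K where "K = \<Theta> - ball \<theta>0 \<epsilon>"
  have K: "compact K" "K \<subseteq> \<Theta>" "\<theta>0 \<notin> K"
    using compact \<epsilon> by (auto simp: K_def intro: compact_diff)
  have "\<forall>\<theta>\<in>K. \<exists>r h. 0 < r \<and> h \<in> borel_measurable borel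
      \<and> (\<forall>v. \<forall>\<theta>'\<in>\<Theta>. dist \<theta> \<theta>' < r \<longrightarrow> h v \<le> \<rho> v \<theta>')
      \<and> integrable M (\<lambda>\<omega>. h (V \<omega>)) \<and> c < expectation (\<lambda>\<omega>. h (V \<omega>))"
  proof
    fix \<theta>
    assume "\<theta> \<in> K"
    hence \<theta>: "\<theta> \<in> \<Theta>" "\<theta> \<noteq> \<theta>0"
      using K by auto
    have less: "c < expectation (\<lambda>\<omega>. \<rho> (V \<omega>) \<theta>)"
      using ident[OF \<theta>] by (simp add: c_def)
    show "\<exists>r h. 0 < r \<and> h \<in> borel_measurable borel
      \<and> (\<forall>v. \<forall>\<theta>'\<in>\<Theta>. dist \<theta> \<theta>' < r \<longrightarrow> h v \<le> \<rho> v \<theta>')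
      \<and> integrable M (\<lambda>\<omega>. h (V \<omega>)) \<and> c < expectation (\<lambda>\<omega>. h (V \<omega>))"
      by (rule expectation_local_infimum[OF V compact \<theta>(1) cont meas B dom less])
  qed
  from bchoice[OF this] obtain r where "\<forall>\<theta>\<in>K. \<exists>h. 0 < r \<theta> \<and> h \<in> borel_measurable borel
      \<and> (\<forall>v. \<forall>\<theta>'\<in>\<Theta>. dist \<theta> \<theta>' < r \<theta> \<longrightarrow> h v \<le> \<rho> v \<theta>')
      \<and> integrable M (\<lambda>\<omega>. h (V \<omega>)) \<and> c < expectation (\<lambda>\<omega>. h (V \<omega>))" ..
  from bchoice[OF this] obtain h where rh: "\<forall>\<theta>\<in>K. 0 < r \<theta> \<and> h \<theta> \<in> borel_measurable borel
      \<and> (\<forall>v. \<forall>\<theta>'\<in>\<Theta>. dist \<theta> \<theta>' < r \<theta> \<longrightarrow> h \<theta> v \<le> \<rho> v \<theta>')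
      \<and> integrable M (\<lambda>\<omega>. h \<theta> (V \<omega>)) \<and> c < expectation (\<lambda>\<omega>. h \<theta> (V \<omega>))" ..
  have r: "0 < r \<theta>" and h_meas: "h \<theta> \<in> borel_measurable borel"
    and h_int: "integrable M (\<lambda>\<omega>. h \<theta> (V \<omega>))" and h_mean: "c < expectation (\<lambda>\<omega>. h \<theta> (V \<omega>))"
    if "\<theta> \<in> K" for \<theta>
    using rh that by auto
  have h_le: "h \<theta> v \<le> \<rho> v \<theta>'" if "\<theta> \<in> K" "\<theta>' \<in> \<Theta>" "dist \<theta> \<theta>' < r \<theta>" for \<theta> v \<theta>'
    using rh that by blast
  have "K \<subseteq> (\<Union>\<theta>\<in>K. ball \<theta> (r \<theta>))"
    using r by auto
  then obtain C where C: "C \<subseteq> K" "finite C" "K \<subseteq> (\<Union>\<theta>\<in>C. ball \<theta> (r \<theta>))"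
    using compactE_image[OF K(1), of K "\<lambda>\<theta>. ball \<theta> (r \<theta>)"] by auto
  \<comment> \<open>A quarter of the gap: three deviations of at most
    \<open>\<delta> \<theta>\<close> cannot close a gap of four times that size.\<close>
  define \<delta> where "\<delta> = (\<lambda>\<theta>. (expectation (\<lambda>\<omega>. h \<theta> (V \<omega>)) - c) / 4)"
  have \<delta>: "0 < \<delta> \<theta>" if "\<theta> \<in> C" for \<theta>
    using h_mean[of \<theta>] that C(1) by (auto simp: \<delta>_def)
  define E1 where "E1 = (\<lambda>\<theta> n. {\<omega> \<in> space M. dist (1 / real n * (\<Sum>i<n. h \<theta> (Vs i \<omega>))) (expectation (\<lambda>\<omega>. h \<theta> (V \<omega>))) > \<delta> \<theta>})"
  \<comment> \<open>This event and the next depend on \<open>\<theta>\<close> only through the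
    margin \<open>\<delta> \<theta>\<close>.\<close>
  define E2 where "E2 = (\<lambda>\<theta> n. {\<omega> \<in> space M. dist (1 / real n * (\<Sum>i<n. \<rho> (Vs i \<omega>) \<theta>0)) c > \<delta> \<theta>})"
  define E3 where "E3 = (\<lambda>\<theta> n. {\<omega> \<in> space M. dist (R n \<omega>) 0 > \<delta> \<theta>})"
  have E_sets: "E1 \<theta> n \<in> events" "E2 \<theta> n \<in> events" "E3 \<theta> n \<in> events" if \<theta>: "\<theta> \<in> C" for \<theta> n
  proof -
    have [measurable]: "h \<theta> \<in> borel_measurable borel" "(\<lambda>v. \<rho> v \<theta>0) \<in> borel_measurable borel"
      using h_meas \<theta> C(1) meas[OF \<theta>0] by auto
    show "E1 \<theta> n \<in> events" "E2 \<theta> n \<in> events" "E3 \<theta> n \<in> events"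
      unfolding E1_def E2_def E3_def by measurable
  qed
  have E_lim: "(\<lambda>n. prob (E1 \<theta> n)) \<longlonglongrightarrow> 0" "(\<lambda>n. prob (E2 \<theta> n)) \<longlonglongrightarrow> 0" "(\<lambda>n. prob (E3 \<theta> n)) \<longlonglongrightarrow> 0"
    if \<theta>: "\<theta> \<in> C" for \<theta>
    using lln[OF h_meas h_int, of \<theta>] lln[OF meas[OF \<theta>0] c_int] R \<delta>[OF \<theta>] \<theta> C(1)
    unfolding E1_def E2_def E3_def conv_in_prob_def c_def by auto
  have cover: "{\<omega> \<in> space M. dist (\<theta>hat n \<omega>) \<theta>0 > \<epsilon>} \<subseteq> (\<Union>\<theta>\<in>C. E1 \<theta> n \<union> E2 \<theta> n \<union> E3 \<theta> n)" for n
  proof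
    fix \<omega>
    assume "\<omega> \<in> {\<omega> \<in> space M. dist (\<theta>hat n \<omega>) \<theta>0 > \<epsilon>}"
    hence \<omega>: "\<omega> \<in> space M" and "\<theta>hat n \<omega> \<in> K"
      using est_in by (auto simp: K_def dist_commute)
    then obtain \<theta> where \<theta>: "\<theta> \<in> C" "dist \<theta> (\<theta>hat n \<omega>) < r \<theta>"
      using C(3) by auto
    have "1 / real n * (\<Sum>i<n. h \<theta> (Vs i \<omega>)) \<le> 1 / real n * (\<Sum>i<n. \<rho> (Vs i \<omega>) (\<theta>hat n \<omega>))"
      using \<theta> C(1) est_in[OF \<omega>] by (intro mult_left_mono sum_mono h_le) auto
    hence "1 / real n * (\<Sum>i<n. h \<theta> (Vs i \<omega>)) \<le> 1 / real n * (\<Sum>i<n. \<rho> (Vs i \<omega>) \<theta>0) + R n \<omega>"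
      using est_min[OF \<omega>, of n] by linarith
    hence "\<omega> \<in> E1 \<theta> n \<union> E2 \<theta> n \<union> E3 \<theta> n"
      using \<omega> \<delta>[OF \<theta>(1)] \<delta>_def unfolding E1_def E2_def E3_def dist_real_def Un_iff mem_Collect_eq
      by (simp only: simp_thms) argo
    thus "\<omega> \<in> (\<Union>\<theta>\<in>C. E1 \<theta> n \<union> E2 \<theta> n \<union> E3 \<theta> n)"
      using \<theta>(1) by blast
  qed
  have bound: "prob {\<omega> \<in> space M. dist (\<theta>hat n \<omega>) \<theta>0 > \<epsilon>}
      \<le> (\<Sum>\<theta>\<in>C. prob (E1 \<theta> n) + prob (E2 \<theta> n) + prob (E3 \<theta> n))" for n
  proof -
    have "prob {\<omega> \<in> space M. dist (\<theta>hat n \<omega>) \<theta>0 > \<epsilon>} \<le> prob (\<Union>\<theta>\<in>C. E1 \<theta> n \<union> E2 \<theta> n \<union> E3 \<theta> n)"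
      using E_sets C(2) by (intro finite_measure_mono cover sets.finite_UN) auto
    also have "\<dots> \<le> (\<Sum>\<theta>\<in>C. prob (E1 \<theta> n \<union> E2 \<theta> n \<union> E3 \<theta> n))"
      using E_sets C(2) by (intro finite_measure_subadditive_finite) auto
    also have "\<dots> \<le> (\<Sum>\<theta>\<in>C. prob (E1 \<theta> n) + prob (E2 \<theta> n) + prob (E3 \<theta> n))"
      using E_sets by (intro sum_mono order_trans[OF measure_Un_le] add_mono measure_Un_le) auto
    finally show ?thesis .
  qed
  have "(\<lambda>n. \<Sum>\<theta>\<in>C. prob (E1 \<theta> n) + prob (E2 \<theta> n) + prob (E3 \<theta> n)) \<longlonglongrightarrow> 0"
    using E_lim by (intro tendsto_null_sum tendsto_add_zero)
  thus "(\<lambda>n. prob {\<omega> \<in> space M. dist (\<theta>hat n \<omega>) \<theta>0 > \<epsilon>}) \<longlonglongrightarrow> 0"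
    by (rule Lim_null_comparison[rotated]) (simp add: bound)
qed

section \<open>The joint quantile and expected shortfall loss\<close>

lemma Ck_real_imp_differentiable: "Ck_real k g \<Longrightarrow> j < k \<Longrightarrow> (deriv ^^ j) g differentiable (at x)"
  by (auto simp: Ck_real_def)

lemma Ck_real_imp_isCont: "Ck_real (Suc k) g \<Longrightarrow> isCont g x"
  using Ck_real_imp_differentiable[of "Suc k" g 0 x] by (auto intro: differentiable_imp_continuous_within)

text \<open>The derivative \<open>g'\<close> coincides with \<open>deriv g\<close>, so smoothness of
  \<open>g\<close> makes it differentiable. This yields the continuity of \<open>G2\<close> and the
  strict monotonicity behind the Bregman bound.\<close>

lemma Ck_real_deriv_strict_mono:
  assumes Ck: "Ck_real (Suc (Suc k)) g" and deriv: "\<And>x. (g has_real_derivative g' x) (at x)"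
    and pos: "\<And>x. 0 < deriv g' x"
  shows "strict_mono g'" and "isCont g' x"
proof -
  have "deriv g = g'"
    using deriv by (intro ext DERIV_imp_deriv)
  hence diff: "g' differentiable (at x)" for x
    using Ck_real_imp_differentiable[OF Ck, of 1 x] by simp
  thus "isCont g' x"
    by (rule differentiable_imp_continuous_within)
  have deriv': "DERIV g' x :> deriv g' x" for x
    using diff DERIV_deriv_iff_real_differentiable by blast
  show "strict_mono g'"
  proof (rule strict_monoI)
    show "g' x < g' y" if "x < y" for x y
      using that by (rule DERIV_pos_imp_increasing) (use deriv' pos in auto)
  qed
qed

lemma abs_le_SUP_compact:
  assumes "compact S" "continuous_on S g" "s \<in> S"
  shows "\<bar>g s\<bar> \<le> (SUP s\<in>S. \<bar>g s :: real\<bar>)"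
  using assms
  by (intro cSUP_upper bounded_imp_bdd_above compact_imp_bounded compact_continuous_image continuous_intros)

text \<open>The supremum runs over a possibly uncountable set, but it is lower semicontinuous in
  \<open>x\<close>: each strict superlevel set is a union of open sets.\<close>

lemma borel_measurable_SUP_abs_compact:
  fixes g :: "real \<Rightarrow> real" and p :: "'p :: topological_space \<Rightarrow> 'x :: euclidean_space"
  assumes S: "compact S" "S \<noteq> {}" and g: "\<And>x. isCont g x" and p: "continuous_on S p"
  shows "(\<lambda>x. SUP s\<in>S. \<bar>g (x \<bullet> p s)\<bar>) \<in> borel_measurable borel"
  unfolding borel_measurable_iff_greater
proof
  fix c
  have g_cont: "continuous_on T g" for T
    using g by (simp add: continuous_at_imp_continuous_on)
  have bdd: "bdd_above ((\<lambda>s. \<bar>g (x \<bullet> p s)\<bar>) ` S)" for x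
    by (intro bounded_imp_bdd_above compact_imp_bounded compact_continuous_image S continuous_intros
        continuous_on_compose2[OF g_cont] p) auto
  have "{x. c < (SUP s\<in>S. \<bar>g (x \<bullet> p s)\<bar>)} = (\<Union>s\<in>S. {x. c < \<bar>g (x \<bullet> p s)\<bar>})"
    using less_cSUP_iff[OF S(2) bdd] by auto
  also have "open \<dots>"
    by (intro open_UN ballI open_Collect_less continuous_intros continuous_on_compose2[OF g_cont]) auto
  finally show "{x \<in> space borel. c < (SUP s\<in>S. \<bar>g (x \<bullet> p s)\<bar>)} \<in> sets borel"
    by simp
qed

section \<open>Bounds and continuity of the loss\<close>

lemma maxnorm_ge: "\<bar>x $ i\<bar> \<le> maxnorm x"
  by (auto simp: maxnorm_def intro: Max_ge)

text \<open>Cauchy-Schwarz combined with the bound of the Euclidean norm by the sum of the absolute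
  coordinates. It connects the linear predictors with moment conditions stated in the maximum
  norm.\<close>

lemma abs_inner_le_maxnorm:
  fixes x v :: "real ^ 'k"
  shows "\<bar>x \<bullet> v\<bar> \<le> CARD('k) * norm v * maxnorm x"
proof -
  have "norm x \<le> (\<Sum>i\<in>UNIV. \<bar>x $ i\<bar>)"
    by (rule norm_le_l1_cart)
  also have "\<dots> \<le> (\<Sum>i\<in>(UNIV :: 'k set). maxnorm x)"
    by (intro sum_mono maxnorm_ge)
  finally have "norm x * norm v \<le> (CARD('k) * maxnorm x) * norm v"
    by (intro mult_right_mono) auto
  thus ?thesis
    using Cauchy_Schwarz_ineq2[of x v] by (simp add: mult_ac)
qed

text \<open>Replacing indicators by maxima makes continuity in \<open>\<theta>\<close> visible: at
  \<open>y = x \<bullet> fst \<theta>\<close> the jump of the indicator is multiplied by differences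
  that vanish there.\<close>

lemma rho_loss_eq:
  assumes "mono G1"
  shows "rho_loss \<alpha> G1 G2 GG a y x \<theta> = G1 (max (x \<bullet> fst \<theta>) y) - G1 y - \<alpha> * G1 (x \<bullet> fst \<theta>)
    + G2 (x \<bullet> snd \<theta>) * (x \<bullet> snd \<theta> - x \<bullet> fst \<theta> + max (x \<bullet> fst \<theta> - y) 0 / \<alpha>)
    - GG (x \<bullet> snd \<theta>) + a y"
  by (simp add: rho_loss_def Let_def max_def algebra_simps)

lemma continuous_on_rho_loss:
  assumes "mono G1" "\<And>x. isCont G1 x" "\<And>x. isCont G2 x" "\<And>x. isCont GG x" "0 < \<alpha>"
  shows "continuous_on S (rho_loss \<alpha> G1 G2 GG a y x)"
proof -
  have cont: "continuous_on T G1" "continuous_on T G2" "continuous_on T GG" for T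
    using assms by (simp_all add: continuous_at_imp_continuous_on)
  have "continuous_on S (\<lambda>\<theta>. rho_loss \<alpha> G1 G2 GG a y x \<theta>)"
    unfolding rho_loss_eq[OF assms(1)]
    by (intro continuous_intros cont[THEN continuous_on_compose2]) (use \<open>0 < \<alpha>\<close> in auto)
  thus ?thesis .
qed

lemma borel_measurable_rho_loss [measurable]:
  assumes [measurable]: "G1 \<in> borel_measurable borel" "G2 \<in> borel_measurable borel"
    "GG \<in> borel_measurable borel" "a \<in> borel_measurable borel"
    and [measurable]: "y \<in> borel_measurable N" "x \<in> borel_measurable N"
  shows "(\<lambda>w. rho_loss \<alpha> G1 G2 GG a (y w) (x w) \<theta>) \<in> borel_measurable N"
  unfolding rho_loss_def Let_def by measurable

text \<open>A termwise triangle inequality. With suprema over the parameter set for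
  \<open>s1\<close>, \<open>s2\<close>, \<open>s3\<close> and a uniform predictor bound for
  \<open>m\<close>, the right-hand side no longer involves \<open>\<theta>\<close> and serves as an
  envelope.\<close>

lemma abs_rho_loss_le:
  fixes x :: "real ^ 'k" and \<theta> :: "(real ^ 'k) \<times> (real ^ 'k)"
  assumes \<alpha>: "0 < \<alpha>" "\<alpha> < 1"
    and G1: "\<bar>G1 (x \<bullet> fst \<theta>)\<bar> \<le> s1" and G2: "\<bar>G2 (x \<bullet> snd \<theta>)\<bar> \<le> s2" and GG: "\<bar>GG (x \<bullet> snd \<theta>)\<bar> \<le> s3"
    and q: "\<bar>x \<bullet> fst \<theta>\<bar> \<le> m" and e: "\<bar>x \<bullet> snd \<theta>\<bar> \<le> m"
  shows "\<bar>rho_loss \<alpha> G1 G2 GG a y x \<theta>\<bar> \<le> s1 + \<bar>G1 y\<bar> + s2 * (2 * m + m / \<alpha> + \<bar>y\<bar> / \<alpha>) + s3 + \<bar>a y\<bar>"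
proof -
  define q e where "q = x \<bullet> fst \<theta>" and "e = x \<bullet> snd \<theta>"
  define J :: real where "J = (if y \<le> q then 1 else 0)"
  have J: "0 \<le> J" "J \<le> 1" "\<bar>J - \<alpha>\<bar> \<le> 1"
    using \<alpha> by (auto simp: J_def)
  have "\<bar>(J - \<alpha>) * G1 q\<bar> \<le> 1 * s1"
    unfolding abs_mult using J G1 by (intro mult_mono) (auto simp: q_def)
  moreover have "\<bar>J * G1 y\<bar> \<le> 1 * \<bar>G1 y\<bar>"
    unfolding abs_mult using J by (intro mult_right_mono) auto
  moreover have "\<bar>G2 e * (e - q + (q - y) * J / \<alpha>)\<bar> \<le> s2 * (2 * m + m / \<alpha> + \<bar>y\<bar> / \<alpha>)"
  proof -
    have "\<bar>(q - y) * J\<bar> \<le> (m + \<bar>y\<bar>) * 1"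
      unfolding abs_mult using J q by (intro mult_mono) (auto simp: q_def)
    hence "\<bar>(q - y) * J / \<alpha>\<bar> \<le> (m + \<bar>y\<bar>) / \<alpha>"
      using \<alpha> by (simp add: abs_divide divide_right_mono)
    hence "\<bar>e - q + (q - y) * J / \<alpha>\<bar> \<le> 2 * m + m / \<alpha> + \<bar>y\<bar> / \<alpha>"
      using q e unfolding q_def[symmetric] e_def[symmetric] add_divide_distrib by linarith
    thus ?thesis
      unfolding abs_mult using G2 by (intro mult_mono) (auto simp: e_def)
  qed
  moreover have "\<bar>GG e\<bar> \<le> s3"
    using GG by (simp add: e_def)
  moreover have "\<bar>p1 - p2 + p3 - p4 + p5\<bar> \<le> b1 + b2 + b3 + b4 + \<bar>p5\<bar>"
    if "\<bar>p1\<bar> \<le> b1" "\<bar>p2\<bar> \<le> b2" "\<bar>p3\<bar> \<le> b3" "\<bar>p4\<bar> \<le> b4" for p1 p2 p3 p4 p5 b1 b2 b3 b4 :: real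
    using that by linarith
  ultimately have "\<bar>(J - \<alpha>) * G1 q - J * G1 y + G2 e * (e - q + (q - y) * J / \<alpha>) - GG e + a y\<bar>
      \<le> s1 + \<bar>G1 y\<bar> + s2 * (2 * m + m / \<alpha> + \<bar>y\<bar> / \<alpha>) + s3 + \<bar>a y\<bar>"
    by (simp only: mult_1)
  thus ?thesis
    by (simp add: rho_loss_def Let_def J_def q_def e_def)
qed

text \<open>Applying the second moment matrix to \<open>v\<close> gives the mean of \<open>X\<close>
  times \<open>X \<bullet> v\<close>, which is zero. The quadratic form therefore vanishes at
  \<open>v\<close>, which positive definiteness permits only for \<open>v = 0\<close>.\<close>

lemma AE_inner_eq_zero_imp_zero:
  fixes X :: "'a \<Rightarrow> real ^ 'k"
  assumes X [measurable]: "X \<in> borel_measurable M"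
    and mom: "integrable M (\<lambda>\<omega>. (maxnorm (X \<omega>))\<^sup>2)"
    and pd: "pos_def_mat (\<chi> i j. LINT \<omega>|M. X \<omega> $ i * X \<omega> $ j)"
    and zero: "AE \<omega> in M. X \<omega> \<bullet> v = 0"
  shows "v = 0"
proof (rule ccontr)
  assume "v \<noteq> 0"
  have [measurable]: "(\<lambda>\<omega>. X \<omega> $ i) \<in> borel_measurable M" for i
    by (intro measurable_compose[OF X borel_measurable_continuous_onI] continuous_intros)
  let ?A = "\<chi> i j. LINT \<omega>|M. X \<omega> $ i * X \<omega> $ j"
  have int: "integrable M (\<lambda>\<omega>. X \<omega> $ i * X \<omega> $ j)" for i j
  proof (rule Bochner_Integration.integrable_bound[OF mom])
    show "(\<lambda>\<omega>. X \<omega> $ i * X \<omega> $ j) \<in> borel_measurable M"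
      by measurable
    have "norm (X \<omega> $ i * X \<omega> $ j) \<le> norm ((maxnorm (X \<omega>))\<^sup>2)" for \<omega>
    proof -
      have "\<bar>X \<omega> $ i\<bar> * \<bar>X \<omega> $ j\<bar> \<le> maxnorm (X \<omega>) * maxnorm (X \<omega>)"
        using maxnorm_ge[of "X \<omega>" i] by (intro mult_mono maxnorm_ge) auto
      thus ?thesis
        by (simp add: abs_mult power2_eq_square)
    qed
    thus "AE \<omega> in M. norm (X \<omega> $ i * X \<omega> $ j) \<le> norm ((maxnorm (X \<omega>))\<^sup>2)"
      by simp
  qed
  have "(?A *v v) $ i = 0" for i
  proof -
    have "(?A *v v) $ i = (\<Sum>j\<in>UNIV. (LINT \<omega>|M. X \<omega> $ i * X \<omega> $ j) * v $ j)"
      by (simp add: matrix_vector_mult_def)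
    also have "\<dots> = (LINT \<omega>|M. (\<Sum>j\<in>UNIV. X \<omega> $ i * X \<omega> $ j * v $ j))"
      using int by (subst Bochner_Integration.integral_sum) auto
    also have "\<dots> = (LINT \<omega>|M. X \<omega> $ i * (X \<omega> \<bullet> v))"
      by (simp add: inner_vec_def sum_distrib_left mult.assoc)
    also have "\<dots> = (LINT \<omega>|M. 0)"
      using zero by (intro integral_cong_AE) auto
    finally show ?thesis
      by simp
  qed
  hence "v \<bullet> (?A *v v) = 0"
    by (simp add: inner_vec_def)
  thus False
    using pd \<open>v \<noteq> 0\<close> by (auto simp: pos_def_mat_def)
qed

theorem theorem2:
  fixes M :: "'a measure"
    and \<alpha> :: real
    and Y :: "'a \<Rightarrow> real" and X :: "'a \<Rightarrow> real ^ 'k"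
    and Ys :: "nat \<Rightarrow> 'a \<Rightarrow> real" and Xs :: "nat \<Rightarrow> 'a \<Rightarrow> real ^ 'k"
    and f :: "real ^ 'k \<Rightarrow> real \<Rightarrow> real"
    and \<Theta> :: "((real ^ 'k) \<times> (real ^ 'k)) set"
    and \<theta>0 :: "(real ^ 'k) \<times> (real ^ 'k)"
    and G1 G2 \<G>2 a :: "real \<Rightarrow> real"
    and \<theta>hat :: "nat \<Rightarrow> 'a \<Rightarrow> (real ^ 'k) \<times> (real ^ 'k)"
    and R :: "nat \<Rightarrow> 'a \<Rightarrow> real"
  assumes alpha: "0 < \<alpha>" "\<alpha> < 1"
    and prob: "prob_space M" and complete: "complete_measure M"
    and Y_rv: "Y \<in> borel_measurable M" and X_rv: "X \<in> borel_measurable M"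
    \<comment> \<open>f is a conditional density of Y given X (a version of it)\<close>
    and f_meas: "(\<lambda>(x, t). f x t) \<in> borel_measurable borel"
    and f_nonneg: "\<And>x t. 0 \<le> f x t"
    and f_int: "\<And>x. integrable lborel (f x)"
    and f_one: "\<And>x. (LINT t|lborel. f x t) = 1"
    and f_cond: "\<And>y B. B \<in> sets borel \<Longrightarrow>
        measure M {\<omega> \<in> space M. Y \<omega> \<le> y \<and> X \<omega> \<in> B}
          = (LINT \<omega>|M. indicator B (X \<omega>) * cond_cdf f (X \<omega>) y)"
    \<comment> \<open>model (M)\<close>
    and Theta: "compact \<Theta>" "interior \<Theta> \<noteq> {}" and theta0: "\<theta>0 \<in> \<Theta>"
    and model_q: "AE \<omega> in M. quantile (cond_cdf f (X \<omega>)) \<alpha> = X \<omega> \<bullet> fst \<theta>0"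
    and model_e: "AE \<omega> in M. expected_shortfall (cond_cdf f (X \<omega>)) \<alpha> = X \<omega> \<bullet> snd \<theta>0"
    \<comment> \<open>(A-1)\<close>
    and sample_rv: "\<And>i. (\<lambda>\<omega>. (Ys i \<omega>, Xs i \<omega>)) \<in> borel_measurable M"
    and iid_indep: "prob_space.indep_vars M (\<lambda>_. borel) (\<lambda>i \<omega>. (Ys i \<omega>, Xs i \<omega>)) UNIV"
    and iid_distr: "\<And>i. distr M borel (\<lambda>\<omega>. (Ys i \<omega>, Xs i \<omega>)) = distr M borel (\<lambda>\<omega>. (Y \<omega>, X \<omega>))"
    and cond_second_moment: "AE \<omega> in M. integrable lborel (\<lambda>t. t\<^sup>2 * f (X \<omega>) t)"
    and f_local: "AE \<omega> in M. \<exists>\<epsilon>>0.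
         (\<forall>t \<in> ball (X \<omega> \<bullet> fst \<theta>0) \<epsilon>. 0 < f (X \<omega>) t)
       \<and> continuous_on (ball (X \<omega> \<bullet> fst \<theta>0) \<epsilon>) (f (X \<omega>))
       \<and> bounded (f (X \<omega>) ` ball (X \<omega> \<bullet> fst \<theta>0) \<epsilon>)"
    \<comment> \<open>(A-2)\<close>
    and A2: "pos_def_mat (\<chi> i j. prob_space.expectation M (\<lambda>\<omega>. X \<omega> $ i * X \<omega> $ j))"
    \<comment> \<open>(A-3)\<close>
    and G1_C2: "Ck_real 2 G1" and G1_mono: "mono G1"
    and G1_locint: "\<And>s t. set_integrable lborel {s..t} G1"
    and G2c_C3: "Ck_real 3 \<G>2"
    and G2c_deriv: "\<And>x. (\<G>2 has_real_derivative G2 x) (at x)"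
    and G2_pos: "\<And>x. 0 < G2 x" and G2'_pos: "\<And>x. 0 < deriv G2 x"
    and a_meas: "a \<in> borel_measurable borel"
    and a_locint: "\<And>s t. set_integrable lborel {s..t} a"
    \<comment> \<open>moment conditions\<close>
    and mom1: "integrable M (\<lambda>\<omega>. (maxnorm (X \<omega>))\<^sup>2)"
    and mom2: "integrable M (\<lambda>\<omega>. SUP \<theta>\<in>\<Theta>. \<bar>G1 (X \<omega> \<bullet> fst \<theta>)\<bar>)"
    and mom3: "integrable M (\<lambda>\<omega>. G1 (Y \<omega>))"
    and mom4: "integrable M (\<lambda>\<omega>. a (Y \<omega>))"
    and mom5: "integrable M (\<lambda>\<omega>. maxnorm (X \<omega>) * (SUP \<theta>\<in>\<Theta>. \<bar>G2 (X \<omega> \<bullet> snd \<theta>)\<bar>))"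
    and mom6: "integrable M (\<lambda>\<omega>. (SUP \<theta>\<in>\<Theta>. \<bar>G2 (X \<omega> \<bullet> snd \<theta>)\<bar>)
                                   * (LINT t|lborel. \<bar>t\<bar> * f (X \<omega>) t))"
    and mom7: "integrable M (\<lambda>\<omega>. SUP \<theta>\<in>\<Theta>. \<bar>\<G>2 (X \<omega> \<bullet> snd \<theta>)\<bar>)"
    \<comment> \<open>the estimator sequence\<close>
    and est_meas: "\<And>n. \<theta>hat n \<in> borel_measurable M"
    and est_in: "\<And>n \<omega>. \<omega> \<in> space M \<Longrightarrow> \<theta>hat n \<omega> \<in> \<Theta>"
    and R_meas: "\<And>n. R n \<in> borel_measurable M"
    and R_oP: "conv_in_prob M R 0"
    and est_min: "\<And>n \<omega>. \<omega> \<in> space M \<Longrightarrow>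
        (1 / real n) * (\<Sum>i<n. rho_loss \<alpha> G1 G2 \<G>2 a (Ys i \<omega>) (Xs i \<omega>) (\<theta>hat n \<omega>))
          \<le> (1 / real n) * (\<Sum>i<n. rho_loss \<alpha> G1 G2 \<G>2 a (Ys i \<omega>) (Xs i \<omega>) \<theta>0) + R n \<omega>"
  shows "conv_in_prob M \<theta>hat \<theta>0"
proof -
  interpret conditional_density M X Y f
    by (intro conditional_density.intro prob conditional_density_axioms.intro)
       (fact X_rv Y_rv f_meas f_nonneg f_int f_one f_cond)+
  note [measurable] = Y_rv X_rv a_meas
  let ?V = "\<lambda>\<omega>. (Y \<omega>, X \<omega>)"
  let ?\<rho> = "\<lambda>v :: real \<times> (real ^ 'k). rho_loss \<alpha> G1 G2 \<G>2 a (fst v) (snd v)"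
  let ?Vs = "\<lambda>i \<omega>. (Ys i \<omega>, Xs i \<omega>)"

  \<comment> \<open>Regularity of the loss and conditional first moments\<close>
  have G1_cont: "isCont G1 x" for x
    using G1_C2 by (auto simp: numeral_2_eq_2 intro: Ck_real_imp_isCont)
  have G2c_cont: "isCont \<G>2 x" for x
    using G2c_deriv by (rule DERIV_isCont)
  have "Ck_real (Suc (Suc 1)) \<G>2"
    using G2c_C3 by (simp add: numeral_3_eq_3)
  from Ck_real_deriv_strict_mono[OF this G2c_deriv G2'_pos]
  have G2_mono: "strict_mono G2" and G2_cont: "isCont G2 x" for x
    by auto
  have G_meas [measurable]: "G1 \<in> borel_measurable borel" "G2 \<in> borel_measurable borel" "\<G>2 \<in> borel_measurable borel"
    using G1_cont G2_cont G2c_cont by (auto intro!: borel_measurable_continuous_onI continuous_at_imp_continuous_on)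
  have fst_snd: "fst \<in> borel_measurable (borel :: (real \<times> (real ^ 'k)) measure)"
      "snd \<in> borel_measurable (borel :: (real \<times> (real ^ 'k)) measure)"
    by (intro borel_measurable_continuous_onI continuous_intros)+
  have V: "?V \<in> borel_measurable M"
    by measurable
  have meas: "(\<lambda>v. ?\<rho> v \<theta>) \<in> borel_measurable borel" for \<theta>
    by (intro borel_measurable_rho_loss G_meas a_meas fst_snd)
  have cont: "continuous_on \<Theta> (?\<rho> v)" for v
    using alpha by (intro continuous_on_rho_loss G1_mono G1_cont G2_cont G2c_cont)
  have density: "real_density (f x)" for x
    using f_int[of x] f_nonneg f_one by unfold_locales auto
  have first_moment: "AE \<omega> in M. integrable lborel (\<lambda>t. t * f (X \<omega>) t)"
    using cond_second_moment
  proof eventually_elim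
    case (elim \<omega>)
    \<comment> \<open>The conditional first moment is dominated through
      \<open>\<bar>t\<bar> \<le> 1 + t^2\<close>, where the constant integrates to 1 against the
      density.\<close>
    have "integrable lborel (\<lambda>t. f (X \<omega>) t + t\<^sup>2 * f (X \<omega>) t)"
      using elim f_int by (rule Bochner_Integration.integrable_add[rotated])
    thus ?case
    proof (rule Bochner_Integration.integrable_bound)
      have "f (X \<omega>) \<in> borel_measurable borel"
        using f_int[of "X \<omega>"] by auto
      thus "(\<lambda>t. t * f (X \<omega>) t) \<in> borel_measurable lborel"
        by simp
      have "\<bar>t\<bar> * f (X \<omega>) t \<le> (1 + t\<^sup>2) * f (X \<omega>) t" for t
      proof (rule mult_right_mono[OF _ f_nonneg])
        show "\<bar>t\<bar> \<le> 1 + t\<^sup>2"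
          using sum_squares_bound[of 1 "\<bar>t\<bar>"] by simp
      qed
      thus "AE t in lborel. norm (t * f (X \<omega>) t) \<le> norm (f (X \<omega>) t + t\<^sup>2 * f (X \<omega>) t)"
        using f_nonneg by (intro AE_I2) (simp add: abs_mult algebra_simps)
    qed
  qed

  \<comment> \<open>An integrable envelope for the loss\<close>
  define S1 S2 S3 where "S1 = (\<lambda>x. SUP \<theta>\<in>\<Theta>. \<bar>G1 (x \<bullet> fst \<theta>)\<bar>)"
    and "S2 = (\<lambda>x. SUP \<theta>\<in>\<Theta>. \<bar>G2 (x \<bullet> snd \<theta>)\<bar>)" and "S3 = (\<lambda>x. SUP \<theta>\<in>\<Theta>. \<bar>\<G>2 (x \<bullet> snd \<theta>)\<bar>)"
  have cont_on: "continuous_on T G1" "continuous_on T G2" "continuous_on T \<G>2" for T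
    using G1_cont G2_cont G2c_cont by (simp_all add: continuous_at_imp_continuous_on)
  have S: "\<bar>G1 (x \<bullet> fst \<theta>)\<bar> \<le> S1 x" "\<bar>G2 (x \<bullet> snd \<theta>)\<bar> \<le> S2 x" "\<bar>\<G>2 (x \<bullet> snd \<theta>)\<bar> \<le> S3 x"
    if "\<theta> \<in> \<Theta>" for x \<theta>
    unfolding S1_def S2_def S3_def
    using that by (intro abs_le_SUP_compact Theta(1) continuous_intros cont_on[THEN continuous_on_compose2]; auto)+
  have S2_nonneg: "0 \<le> S2 x" for x
    using S(2)[OF theta0, of x] by linarith
  have S2_meas [measurable]: "S2 \<in> borel_measurable borel"
    unfolding S2_def using theta0
    by (intro borel_measurable_SUP_abs_compact Theta(1) G2_cont continuous_intros) auto
  \<comment> \<open>The condition \<open>mom6\<close> involves the conditional mean of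
    \<open>\<bar>Y\<bar>\<close>; disintegration converts it into integrability of the product with
    \<open>\<bar>Y\<bar>\<close> itself.\<close>
  have S2Y: "integrable M (\<lambda>\<omega>. S2 (X \<omega>) * \<bar>Y \<omega>\<bar>)"
  proof (rule integrableI_bounded)
    have "(\<integral>\<^sup>+\<omega>. ennreal (norm (S2 (X \<omega>) * \<bar>Y \<omega>\<bar>)) \<partial>M)
        = (\<integral>\<^sup>+\<omega>. (case (X \<omega>, Y \<omega>) of (x, t) \<Rightarrow> ennreal (S2 x * \<bar>t\<bar>)) \<partial>M)"
      using S2_nonneg by (simp add: abs_mult)
    also have "\<dots> = (\<integral>\<^sup>+\<omega>. (\<integral>\<^sup>+t. ennreal (f (X \<omega>) t) * (case (X \<omega>, t) of (x, t) \<Rightarrow> ennreal (S2 x * \<bar>t\<bar>)) \<partial>lborel) \<partial>M)"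
      by (rule nn_integral_disintegration) measurable
    also have "\<dots> = (\<integral>\<^sup>+\<omega>. ennreal (S2 (X \<omega>) * (LINT t|lborel. \<bar>t\<bar> * f (X \<omega>) t)) \<partial>M)"
    proof (rule nn_integral_cong_AE)
      show "AE \<omega> in M. (\<integral>\<^sup>+t. ennreal (f (X \<omega>) t) * (case (X \<omega>, t) of (x, t) \<Rightarrow> ennreal (S2 x * \<bar>t\<bar>)) \<partial>lborel)
          = ennreal (S2 (X \<omega>) * (LINT t|lborel. \<bar>t\<bar> * f (X \<omega>) t))"
        using first_moment
      proof eventually_elim
        case (elim \<omega>)
        have "integrable lborel (\<lambda>t. \<bar>t\<bar> * f (X \<omega>) t)"
          using integrable_norm[OF elim] f_nonneg by (simp add: abs_mult)
        hence "(\<integral>\<^sup>+t. ennreal (S2 (X \<omega>) * (\<bar>t\<bar> * f (X \<omega>) t)) \<partial>lborel)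
            = ennreal (S2 (X \<omega>) * (LINT t|lborel. \<bar>t\<bar> * f (X \<omega>) t))"
          using S2_nonneg f_nonneg
          by (subst integral_mult_right_zero[symmetric], intro nn_integral_eq_integral) auto
        thus ?case
          using S2_nonneg f_nonneg by (simp add: ennreal_mult[symmetric] mult_ac)
      qed
    qed
    also have "(\<integral>\<^sup>+\<omega>. ennreal (S2 (X \<omega>) * (LINT t|lborel. \<bar>t\<bar> * f (X \<omega>) t)) \<partial>M)
        \<le> (\<integral>\<^sup>+\<omega>. ennreal (norm (S2 (X \<omega>) * (LINT t|lborel. \<bar>t\<bar> * f (X \<omega>) t))) \<partial>M)"
      by (intro nn_integral_mono ennreal_leI) simp
    also have "\<dots> < \<infinity>"
      using mom6 unfolding S2_def by (simp add: integrable_iff_bounded)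
    finally show "(\<integral>\<^sup>+\<omega>. ennreal (norm (S2 (X \<omega>) * \<bar>Y \<omega>\<bar>)) \<partial>M) < \<infinity>" .
  qed measurable

  obtain b where b: "\<And>\<theta>. \<theta> \<in> \<Theta> \<Longrightarrow> norm \<theta> \<le> b"
    using compact_imp_bounded[OF Theta(1)] by (auto simp: bounded_iff)
  \<comment> \<open>Compactness supplies the radius \<open>b\<close>, so this bounds both linear
    predictors simultaneously over all of \<open>\<Theta>\<close>.\<close>
  define m where "m = (\<lambda>x :: real ^ 'k. CARD('k) * b * maxnorm x)"
  have m: "\<bar>x \<bullet> fst \<theta>\<bar> \<le> m x" "\<bar>x \<bullet> snd \<theta>\<bar> \<le> m x" if "\<theta> \<in> \<Theta>" for x \<theta>
  proof -
    have le: "\<bar>x \<bullet> v\<bar> \<le> m x" if "norm v \<le> b" for v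
      unfolding m_def using that order_trans[OF abs_ge_zero maxnorm_ge]
      by (intro order_trans[OF abs_inner_le_maxnorm] mult_right_mono mult_left_mono) auto
    show "\<bar>x \<bullet> fst \<theta>\<bar> \<le> m x" "\<bar>x \<bullet> snd \<theta>\<bar> \<le> m x"
      using b[OF that] norm_fst_le[of "fst \<theta>" "snd \<theta>"] norm_snd_le[of "snd \<theta>" "fst \<theta>"] by (auto intro: le)
  qed
  define B where "B = (\<lambda>\<omega>. S1 (X \<omega>) + \<bar>G1 (Y \<omega>)\<bar>
    + S2 (X \<omega>) * (2 * m (X \<omega>) + m (X \<omega>) / \<alpha> + \<bar>Y \<omega>\<bar> / \<alpha>) + S3 (X \<omega>) + \<bar>a (Y \<omega>)\<bar>)"
  have dom: "\<bar>?\<rho> (?V \<omega>) \<theta>\<bar> \<le> B \<omega>" if "\<theta> \<in> \<Theta>" for \<omega> \<theta>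
    unfolding B_def fst_conv snd_conv by (intro abs_rho_loss_le alpha S m that)
  have B_int: "integrable M B"
  proof -
    have S_int: "integrable M (\<lambda>\<omega>. S1 (X \<omega>))" "integrable M (\<lambda>\<omega>. maxnorm (X \<omega>) * S2 (X \<omega>))"
      "integrable M (\<lambda>\<omega>. S3 (X \<omega>))"
      using mom2 mom5 mom7 by (simp_all only: S1_def S2_def S3_def)
    \<comment> \<open>The envelope term splits into the quantity of \<open>mom5\<close> and the
      product treated in \<open>S2Y\<close>.\<close>
    have "S2 (X \<omega>) * (2 * m (X \<omega>) + m (X \<omega>) / \<alpha> + \<bar>Y \<omega>\<bar> / \<alpha>)
        = (2 + 1 / \<alpha>) * (CARD('k) * b) * (maxnorm (X \<omega>) * S2 (X \<omega>)) + 1 / \<alpha> * (S2 (X \<omega>) * \<bar>Y \<omega>\<bar>)" for \<omega>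
      unfolding m_def using alpha by (simp add: field_simps)
    thus ?thesis
      unfolding B_def
      by (simp only:) (intro Bochner_Integration.integrable_add integrable_mult_right integrable_abs S_int S2Y mom3 mom4)
  qed
  have loss_int: "integrable M (\<lambda>\<omega>. ?\<rho> (?V \<omega>) \<theta>)" if "\<theta> \<in> \<Theta>" for \<theta>
  proof (rule Bochner_Integration.integrable_bound[OF B_int measurable_compose[OF V meas]])
    show "AE \<omega> in M. norm (?\<rho> (?V \<omega>) \<theta>) \<le> norm (B \<omega>)"
      using dom[OF that] by (intro AE_I2) (metis abs_ge_self order_trans real_norm_def)
  qed

  \<comment> \<open>Identification of the true parameter\<close>
  have ident: "(LINT \<omega>|M. ?\<rho> (?V \<omega>) \<theta>0) < (LINT \<omega>|M. ?\<rho> (?V \<omega>) \<theta>)"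
    if \<theta>: "\<theta> \<in> \<Theta>" and neq: "\<theta> \<noteq> \<theta>0" for \<theta>
  proof (rule ccontr)
    assume not_less: "\<not> ?thesis"
    \<comment> \<open>The arguments are ordered as \<open>(x, t)\<close> to match disintegration,
      whereas the observation \<open>?V\<close> lists \<open>Y\<close> first.\<close>
    define h where "h = (\<lambda>(x, t). rho_loss \<alpha> G1 G2 \<G>2 a t x \<theta> - rho_loss \<alpha> G1 G2 \<G>2 a t x \<theta>0)"
    have h_meas: "h \<in> borel_measurable (borel \<Otimes>\<^sub>M borel)"
      unfolding h_def by measurable
    have h_int: "integrable M (\<lambda>\<omega>. h (X \<omega>, Y \<omega>))"
      using loss_int[OF \<theta>] loss_int[OF theta0] by (simp add: h_def)
    note dis = integral_disintegration[OF h_meas h_int]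
    let ?D = "\<lambda>\<omega>. LINT t|lborel. h (X \<omega>, t) * f (X \<omega>) t"
    have "AE \<omega> in M. 0 \<le> ?D \<omega> \<and> (?D \<omega> = 0 \<longrightarrow> X \<omega> \<bullet> fst \<theta> = X \<omega> \<bullet> fst \<theta>0 \<and> X \<omega> \<bullet> snd \<theta> = X \<omega> \<bullet> snd \<theta>0)"
      using dis(1) first_moment model_q model_e f_local
    proof eventually_elim
      case (elim \<omega>)
      obtain \<epsilon> where \<epsilon>: "0 < \<epsilon>" "\<And>t. t \<in> ball (X \<omega> \<bullet> fst \<theta>0) \<epsilon> \<Longrightarrow> 0 < f (X \<omega>) t"
        using elim(5) by blast
      have d_meas: "(\<lambda>t. rho_loss \<alpha> G1 G2 \<G>2 a t (X \<omega>) \<theta> - rho_loss \<alpha> G1 G2 \<G>2 a t (X \<omega>) \<theta>0) \<in> borel_measurable borel"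
        by measurable
      note excess = rho_loss_excess[OF density alpha G1_mono G2c_deriv G2_mono G2_pos elim(2-4) \<epsilon> d_meas]
      show ?case
        using excess elim(1) by (simp add: h_def)
    qed
    hence D_nonneg: "AE \<omega> in M. 0 \<le> ?D \<omega>"
      and D_zero: "AE \<omega> in M. ?D \<omega> = 0 \<longrightarrow> X \<omega> \<bullet> fst \<theta> = X \<omega> \<bullet> fst \<theta>0 \<and> X \<omega> \<bullet> snd \<theta> = X \<omega> \<bullet> snd \<theta>0"
      by (auto elim: eventually_mono)
    \<comment> \<open>The mean conditional excess is the difference of the risks. It is nonpositive
      by the contrary assumption, so the almost surely nonnegative excess must be zero almost
      surely.\<close>
    have "(LINT \<omega>|M. ?D \<omega>) = (LINT \<omega>|M. ?\<rho> (?V \<omega>) \<theta>) - (LINT \<omega>|M. ?\<rho> (?V \<omega>) \<theta>0)"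
      unfolding dis(3)[symmetric] using loss_int[OF \<theta>] loss_int[OF theta0] by (simp add: h_def)
    hence "(LINT \<omega>|M. ?D \<omega>) = 0"
      using not_less integral_nonneg_AE[OF D_nonneg] by linarith
    hence "AE \<omega> in M. ?D \<omega> = 0"
      using integral_nonneg_eq_0_iff_AE[OF dis(2) D_nonneg] by simp
    hence "AE \<omega> in M. X \<omega> \<bullet> (fst \<theta> - fst \<theta>0) = 0 \<and> X \<omega> \<bullet> (snd \<theta> - snd \<theta>0) = 0"
      using D_zero by eventually_elim (auto simp: inner_diff_right)
    hence ae: "AE \<omega> in M. X \<omega> \<bullet> (fst \<theta> - fst \<theta>0) = 0" "AE \<omega> in M. X \<omega> \<bullet> (snd \<theta> - snd \<theta>0) = 0"
      by auto
    \<comment> \<open>Positive definiteness is applied to the quantile and the shortfall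
      coefficients separately.\<close>
    show False
      using neq AE_inner_eq_zero_imp_zero[OF X_rv mom1 A2 ae(1)] AE_inner_eq_zero_imp_zero[OF X_rv mom1 A2 ae(2)]
      by (simp add: prod_eq_iff)
  qed

  \<comment> \<open>Conclusion by Wald's argument\<close>
  show ?thesis
  proof (rule wald_consistency[where \<rho> = ?\<rho> and V = ?V and Vs = ?Vs and \<Theta> = \<Theta> and B = B and R = R])
    show "(1 / real n) * (\<Sum>i<n. ?\<rho> (?Vs i \<omega>) (\<theta>hat n \<omega>)) \<le> (1 / real n) * (\<Sum>i<n. ?\<rho> (?Vs i \<omega>) \<theta>0) + R n \<omega>"
      if "\<omega> \<in> space M" for n \<omega>
      using est_min[OF that] by simp
  qed (assumption | rule prob V iid_indep iid_distr Theta(1) theta0 cont meas B_int dom ident est_in R_meas R_oP)+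
qed

end
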